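(* Let $n$ be a positive odd integer, and for $k\geqslant 0$ let $$c_q(k)=[4k+1]\frac{(q;q^2)_k^6}{(q^2;q^2)_k^6}q^k.$$ Then $$\sum_{k=0}^{n-1}\sum_{j=0}^{k}c_q(j)c_q(k-j)\equiv q^{1-n}[n]^2\left(\sum_{k=0}^{(n-1)/2}\frac{(q;q^2)_k^4}{(q^2;q^2)_k^4}q^{2k}\right)^2\pmod{[n]\Phi_n(q)^2}.$$
   Context: Here $q$ is an indeterminate. The $q$-shifted factorial is $(x;q)_0=1$ and $(x;q)_m=(1-x)(1-xq)\cdots(1-xq^{m-1})$ for $m\geqslant1$; the $q$-integer is $[m]=1+q+\cdots+q^{m-1}$. $\Phi_n(q)$ is the $n$-th cyclotomic polynomial. For rational functions $A,B$ in $q$ and a polynomial $P$, $A\equiv B\pmod{P}$ means that $A-B=P\cdot U/V$ for polynomials $U,V$ with $V$ coprime to $P$. *)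

theory Defs
  imports Complex_Main "HOL-Computational_Algebra.Computational_Algebra"
begin

definition qpoch :: "'a::comm_ring_1 \<Rightarrow> 'a \<Rightarrow> nat \<Rightarrow> 'a" where
  "qpoch x q m = (\<Prod>i<m. 1 - x * q ^ i)"

definition qint :: "'a::comm_semiring_1 \<Rightarrow> nat \<Rightarrow> 'a" where
  "qint q m = (\<Sum>i<m. q ^ i)"

definition primitive_roots_unity :: "nat \<Rightarrow> complex set" where
  "primitive_roots_unity n = {z. z ^ n = 1 \<and> (\<forall>m\<in>{0<..<n}. z ^ m \<noteq> 1)}"

text \<open>
  The product over the primitive roots of unity is a priori a complex polynomial;
  \<open>of_rat_cyclotomic\<close> below shows that the description is not vacuous for any \<open>n > 0\<close>.
\<close>
definition cyclotomic :: "nat \<Rightarrow> rat poly" where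
  "cyclotomic n =
     (THE p. map_poly of_rat p = (\<Prod>z\<in>primitive_roots_unity n. [:-z, 1:]))"

lemma map_poly_of_rat_add:
  "map_poly of_rat (p + q) = (map_poly of_rat p + map_poly of_rat q :: complex poly)"
  by (rule poly_eqI) (simp add: coeff_map_poly of_rat_add)

lemma map_poly_of_rat_mult:
  "map_poly of_rat (p * q) = (map_poly of_rat p * map_poly of_rat q :: complex poly)"
  by (rule poly_eqI) (simp add: coeff_map_poly coeff_mult of_rat_sum of_rat_mult)

lemma degree_map_poly_of_rat: "degree (map_poly of_rat p :: complex poly) = degree p"
  by (rule degree_map_poly) simp

lemma map_poly_of_rat_inj:
  assumes "map_poly of_rat p = (map_poly of_rat q :: complex poly)"
  shows "p = q"
proof (rule poly_eqI)
  fix i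
  have "of_rat (coeff p i) = (of_rat (coeff q i) :: complex)"
    using arg_cong[OF assms, of "\<lambda>r. coeff r i"] by (simp add: coeff_map_poly)
  thus "coeff p i = coeff q i" by simp
qed

lemma map_poly_of_rat_prod:
  "finite A \<Longrightarrow>
     map_poly of_rat (\<Prod>i\<in>A. f i) = (\<Prod>i\<in>A. map_poly of_rat (f i) :: complex poly)"
  by (induction A rule: finite_induct) (simp_all add: map_poly_of_rat_mult)

lemma map_poly_of_rat_divide:
  fixes r :: "complex poly"
  assumes eq: "map_poly of_rat p = map_poly of_rat q * r" and "q \<noteq> 0"
  shows "\<exists>d. r = map_poly of_rat d"
proof -
  let ?h = "map_poly of_rat :: rat poly \<Rightarrow> complex poly"
  have "?h p = ?h (q * (p div q) + p mod q)" by simp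
  also have "\<dots> = ?h q * ?h (p div q) + ?h (p mod q)"
    by (simp only: map_poly_of_rat_add map_poly_of_rat_mult)
  finally have *: "?h (p mod q) = ?h q * (r - ?h (p div q))"
    using eq by (simp add: algebra_simps)
  have "r - ?h (p div q) = 0"
  proof (rule ccontr)
    assume nz: "r - ?h (p div q) \<noteq> 0"
    have hq: "?h q \<noteq> 0"
      using \<open>q \<noteq> 0\<close> by (metis map_poly_0 map_poly_of_rat_inj)
    have "p mod q \<noteq> 0" using * nz hq by auto
    hence "degree (p mod q) < degree q"
      using \<open>q \<noteq> 0\<close> degree_mod_less by blast
    moreover have "degree (p mod q) = degree q + degree (r - ?h (p div q))"
      using arg_cong[OF *, of degree] nz hq by (simp add: degree_mult_eq degree_map_poly_of_rat)
    ultimately show False by simp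
  qed
  thus ?thesis by auto
qed

lemma finite_primitive_roots_unity: "n > 0 \<Longrightarrow> finite (primitive_roots_unity n)"
  unfolding primitive_roots_unity_def
  by (rule finite_subset[OF _ finite_roots_unity[of n]]) auto

lemma roots_unity_decompose:
  assumes "n > 0"
  shows "{z::complex. z ^ n = 1} = (\<Union>d\<in>{d. d dvd n}. primitive_roots_unity d)"
proof (intro equalityI subsetI)
  fix z :: complex assume "z \<in> {z. z ^ n = 1}"
  hence z: "z ^ n = 1" by simp
  define d where "d = (LEAST d. d > 0 \<and> z ^ d = 1)"
  have d: "d > 0 \<and> z ^ d = 1"
    unfolding d_def by (rule LeastI[of _ n]) (use z assms in auto)
  have least: "z ^ m \<noteq> 1" if "m > 0" "m < d" for m
    using not_less_Least[of m "\<lambda>d. d > 0 \<and> z ^ d = 1"] that unfolding d_def by auto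
  have "z ^ n = z ^ (d * (n div d) + n mod d)" by simp
  also have "\<dots> = z ^ (n mod d)" using d by (simp only: power_add power_mult) simp
  finally have "z ^ (n mod d) = 1" using z by simp
  hence "n mod d = 0" using least[of "n mod d"] d by auto
  hence "d dvd n" by auto
  moreover have "z \<in> primitive_roots_unity d"
    using d least by (auto simp: primitive_roots_unity_def)
  ultimately show "z \<in> (\<Union>d\<in>{d. d dvd n}. primitive_roots_unity d)" by blast
next
  fix z :: complex assume "z \<in> (\<Union>d\<in>{d. d dvd n}. primitive_roots_unity d)"
  thus "z \<in> {z. z ^ n = 1}"
    by (auto simp: primitive_roots_unity_def dvd_def power_mult)
qed

lemma primitive_roots_unity_disjoint:
  assumes "d > 0" "e > 0" "d \<noteq> e"
  shows "primitive_roots_unity d \<inter> primitive_roots_unity e = {}"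
  using assms by (cases d e rule: linorder_cases) (auto simp: primitive_roots_unity_def)

lemma prod_roots_unity:
  assumes "n > 0"
  shows "(\<Prod>z | z ^ n = 1. [:-z, 1:]) = (monom 1 n - 1 :: complex poly)"
proof -
  let ?p = "monom 1 n - 1 :: complex poly"
  have roots: "poly ?p z = 0 \<longleftrightarrow> z ^ n = 1" for z
    by (simp add: poly_monom)
  have deg: "degree ?p = n"
    using degree_add_eq_left[of "- 1 :: complex poly" "monom 1 n"] assms
    by (simp add: degree_monom_eq)
  have lc: "lead_coeff ?p = 1" unfolding deg using assms by (simp add: coeff_1)
  have nz: "?p \<noteq> 0" using deg assms by auto
  have ord: "order z ?p = 1" if "z ^ n = 1" for z
  proof -
    have "poly (pderiv ?p) z \<noteq> 0"
      using that assms
      by (auto simp: pderiv_diff pderiv_monom poly_monom power_0_left)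
    hence "order z (pderiv ?p) = 0"
      using order_root by blast
    moreover have "poly ?p z = 0" using that roots by blast
    ultimately show ?thesis using order_pderiv[OF nz, of z] by simp
  qed
  have "?p = (\<Prod>z | poly ?p z = 0. [:-z, 1:] ^ order z ?p)"
    using complex_poly_decompose[of ?p] lc by simp
  also have "\<dots> = (\<Prod>z | z ^ n = 1. [:-z, 1:])"
    unfolding roots by (intro prod.cong) (simp_all add: ord)
  finally show ?thesis by simp
qed

lemma ex_rat_cyclotomic:
  "n > 0 \<Longrightarrow> \<exists>p. map_poly of_rat p = (\<Prod>z\<in>primitive_roots_unity n. [:-z, 1:])"
proof (induction n rule: less_induct)
  case (less n)
  let ?D = "{d. d dvd n \<and> d < n}"
  let ?P = "\<lambda>d. \<Prod>z\<in>primitive_roots_unity d. [:-z, 1:]"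
  have pos: "d > 0" if "d dvd n" for d using that less.prems by (auto intro: Nat.gr0I)
  have finD: "finite ?D" by simp
  have "\<forall>d\<in>?D. \<exists>p. map_poly of_rat p = ?P d"
    using less.IH pos by blast
  then obtain f where f: "\<And>d. d \<in> ?D \<Longrightarrow> map_poly of_rat (f d) = ?P d"
    by metis
  have D: "{d. d dvd n} = insert n ?D"
    using less.prems by (auto dest: dvd_imp_le)
  have "map_poly of_rat (monom 1 n - 1) = (monom 1 n - 1 :: complex poly)"
    by (rule poly_eqI) (simp add: coeff_map_poly of_rat_diff coeff_1)
  also have "\<dots> = (\<Prod>z\<in>(\<Union>d\<in>{d. d dvd n}. primitive_roots_unity d). [:-z, 1:])"
    using prod_roots_unity roots_unity_decompose less.prems by simp
  also have "\<dots> = (\<Prod>d | d dvd n. ?P d)"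
    using less.prems pos
    by (intro prod.UNION_disjoint)
       (simp_all add: finite_primitive_roots_unity primitive_roots_unity_disjoint)
  also have "\<dots> = (\<Prod>d\<in>?D. ?P d) * ?P n"
    unfolding D using finD by simp
  also have "(\<Prod>d\<in>?D. ?P d) = map_poly of_rat (\<Prod>d\<in>?D. f d)"
    using finD f by (simp add: map_poly_of_rat_prod)
  finally have eq: "map_poly of_rat (monom 1 n - 1) =
                      map_poly of_rat (\<Prod>d\<in>?D. f d) * ?P n" .
  have "(\<Prod>d\<in>?D. f d) \<noteq> 0"
  proof
    assume "(\<Prod>d\<in>?D. f d) = 0"
    then obtain d where d: "d \<in> ?D" "f d = 0" using finD by auto
    hence "?P d = 0" using f[of d] by simp
    moreover have "finite (primitive_roots_unity d)"
      using d pos finite_primitive_roots_unity by blast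
    ultimately show False by simp
  qed
  from map_poly_of_rat_divide[OF eq this] show ?case by metis
qed

lemma of_rat_cyclotomic:
  assumes "n > 0"
  shows "map_poly of_rat (cyclotomic n) = (\<Prod>z\<in>primitive_roots_unity n. [:-z, 1:])"
proof -
  obtain p where p: "map_poly of_rat p = (\<Prod>z\<in>primitive_roots_unity n. [:-z, 1:])"
    using ex_rat_cyclotomic[OF assms] by blast
  show ?thesis unfolding cyclotomic_def
    by (rule theI[of _ p]) (use p map_poly_of_rat_inj in metis)+
qed

abbreviation qX :: "rat poly" where
  "qX \<equiv> [:0, 1:]"

abbreviation qF :: "rat poly fract" where
  "qF \<equiv> to_fract qX"

definition ratfun_cong :: "rat poly fract \<Rightarrow> rat poly fract \<Rightarrow> rat poly \<Rightarrow> bool" where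
  "ratfun_cong A B P \<longleftrightarrow>
     (\<exists>U V. V \<noteq> 0 \<and> coprime V P \<and> A - B = to_fract P * (to_fract U / to_fract V))"

definition cq :: "nat \<Rightarrow> rat poly fract" where
  "cq k = qint qF (4 * k + 1) * (qpoch qF (qF ^ 2) k ^ 6 / qpoch (qF ^ 2) (qF ^ 2) k ^ 6) * qF ^ k"

end

theory Submission
  imports Defs "HOL-Computational_Algebra.Field_as_Ring"
begin

text \<open>
  For \<open>n = 1\<close> both sides are 1.  For \<open>n > 1\<close> the congruence is local at the roots of unity \<open>\<zeta> \<noteq> 1\<close> with
  \<open>\<zeta> ^ n = 1\<close>: \<open>[n] \<Phi>\<^sub>n\<^sup>2\<close> has a triple zero
  at the primitive \<open>n\<close>-th roots and a simple zero at the others.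

  At a primitive \<open>m\<close>-th root (\<open>m = 2 N + 1\<close>), a special case of Watson's
  \<open>\<^sub>8\<phi>\<^sub>7\<close> transformation in which two parameters \<open>q\<close> are replaced by \<open>q\<^bsup>1+m\<^esup>\<close> and \<open>q\<^bsup>1-m\<^esup>\<close> gives
  \<open>S = T\<close> modulo \<open>(1 - q\<^sup>m)\<^sup>2\<close>, where \<open>S = (\<Sum>k\<le>N. cq k)\<close> and \<open>T\<close> is \<open>q\<^bsup>-N\<^esup> [m]\<close> times the sum over
  \<open>k \<le> N\<close> on the right-hand side.  Both \<open>S\<close> and \<open>T\<close> vanish at \<open>\<zeta>\<close>, so \<open>S\<^sup>2 - T\<^sup>2 = (S - T) (S + T)\<close> vanishes
  to order 3.  If \<open>m = n\<close>, the double sum is \<open>S\<^sup>2\<close> up to terms containing some \<open>cq k\<close> with \<open>N < k < n\<close>, and these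
  vanish to order 6.  If \<open>m\<close> is a proper divisor of \<open>n\<close>, then \<open>cq (l m + r) = \<kappa> l * cq r\<close> at \<open>\<zeta>\<close> for \<open>r < m\<close>,
  and the double sum splits into blocks, each of which is a multiple of \<open>S\<^sup>2 = 0\<close>.
\<close>

subsection \<open>A special case of Watson's transformation\<close>

lemma qpoch_0 [simp]: "qpoch x q 0 = 1"
  by (simp add: qpoch_def)

lemma qpoch_Suc: "qpoch x q (Suc m) = qpoch x q m * (1 - x * q ^ m)"
  by (simp add: qpoch_def)

lemma qpoch_add: "qpoch x q (m + n) = qpoch x q m * qpoch (x * q ^ m) q n"
  by (induction n) (simp_all add: qpoch_Suc power_add algebra_simps)

lemma qpoch_Suc_shift: "qpoch x q (Suc m) = (1 - x) * qpoch (x * q) q m"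
  using qpoch_add[of x q 1 m] by (simp add: qpoch_Suc)

lemma qpoch_nonzero:
  fixes x :: "'a::field"
  assumes "\<And>i. i < k \<Longrightarrow> x * q ^ i \<noteq> 1"
  shows "qpoch x q k \<noteq> 0"
  using assms by (auto simp: qpoch_def)

text \<open>Induction step of the two telescoping proofs below: \<open>S\<close> and
  \<open>S'\<close> are partial sums, \<open>t\<close> and \<open>t'\<close> their next terms,
  \<open>R\<close> and \<open>R'\<close> consecutive values of the certificate. It leaves only an
  identity between the new terms to \<open>algebra\<close>.\<close>

lemma creative_telescoping_step:
  fixes a b :: "'a::comm_ring"
  assumes "a * S - b * S' = R" and "a * t - b * t' + R = R'"
  shows "a * (S + t) - b * (S' + t') = R'"
  unfolding assms(2)[symmetric] assms(1)[symmetric] by (simp add: algebra_simps)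

text \<open>
  The \<open>q\<close>-Pfaff--Saalschuetz sum with lower parameter \<open>A * B * D\<close>, cleared of denominators so that
  \<open>A\<close>, \<open>B\<close> and \<open>D\<close> may be arbitrary.
\<close>
lemma q_saalschuetz:
  fixes p A B D :: "'a::field"
  assumes p: "\<And>k. k > 0 \<Longrightarrow> p ^ k \<noteq> 1"
  shows "(\<Sum>j\<le>n. qpoch p p n / (qpoch p p j * qpoch p p (n - j)) * qpoch A p j * qpoch B p j *
            qpoch (A * B * D * p ^ j) p (n - j) * qpoch D p (n - j) * D ^ j)
         = qpoch (B * D) p n * qpoch (A * D) p n"
proof -
  define T where "T n j = qpoch p p n / (qpoch p p j * qpoch p p (n - j)) * qpoch A p j *
    qpoch B p j * qpoch (A * B * D * p ^ j) p (n - j) * qpoch D p (n - j) * D ^ j" for n j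
  have nz: "qpoch p p k \<noteq> 0" for k
    using p by (intro qpoch_nonzero) (metis power_Suc zero_less_Suc)
  have nz1: "1 - p * p ^ k \<noteq> 0" for k
    using p[of "Suc k"] by simp
  \<comment> \<open>Creative telescoping in \<open>n\<close>; the right-hand side is the
    certificate. At \<open>s = n\<close> it is minus the missing term
    \<open>T (Suc n) (Suc n)\<close>, which yields a first-order recurrence that the closed form
    also satisfies.\<close>
  have partial: "(\<Sum>j\<le>s. T (Suc n) j) - (1 - B * D * p ^ n) * (1 - A * D * p ^ n) * (\<Sum>j\<le>s. T n j)
        = - T n s * D * p ^ (n - s) * (1 - A * p ^ s) * (1 - B * p ^ s)" if "s \<le> n" for n s
    using that
  proof (induction s)
    case 0
    have T0: "T (Suc n) 0 = T n 0 * ((1 - A * B * D * p ^ n) * (1 - D * p ^ n))"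
      using nz by (simp add: T_def qpoch_Suc[of "A * B * D"] qpoch_Suc[of D])
    have "T (Suc n) 0 - (1 - B * D * p ^ n) * (1 - A * D * p ^ n) * T n 0
        = - T n 0 * D * p ^ n * (1 - A) * (1 - B)" unfolding T0 by algebra
    thus ?case by simp
  next
    case (Suc s)
    then obtain d where n: "n = Suc (s + d)" by (metis add_Suc le_Suc_ex)
    \<comment> \<open>\<open>U\<close> is the common part of \<open>T n s\<close>,
      \<open>T n (Suc s)\<close> and \<open>T (Suc n) (Suc s)\<close>. Once it is taken out, the
      step is a polynomial identity.\<close>
    define U where "U = qpoch A p s * qpoch B p s * qpoch (A * B * D * p ^ Suc s) p d * qpoch D p d *
        D ^ s * qpoch p p n / (qpoch p p (Suc s) * qpoch p p (Suc d))"
    define x w where "x = p ^ s" and "w = p ^ d"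
    have y: "p ^ n = p * x * w" by (simp add: n x_def w_def power_add)
    have d: "n - s = Suc d" "n - Suc s = d" "Suc n - Suc s = Suc d" "s + d < n" by (auto simp: n)
    have T1: "T n s = U * (1 - p * x) * (1 - A * B * D * x) * (1 - D * w)"
      using nz nz1[of s] unfolding T_def U_def d
      by (simp add: qpoch_Suc_shift[of "A * B * D * p ^ s"] qpoch_Suc[of D] qpoch_Suc[of p p s]
            x_def w_def divide_simps) (simp add: mult_ac)
    have T2: "T n (Suc s) = U * (1 - A * x) * (1 - B * x) * D * (1 - p * w)"
      using nz nz1[of d] unfolding T_def U_def d
      by (simp add: qpoch_Suc[of A] qpoch_Suc[of B] qpoch_Suc[of p p d]
            x_def w_def divide_simps)
    have T3: "T (Suc n) (Suc s) = U * (1 - A * x) * (1 - B * x) * D * (1 - p * (p * x * w)) *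
        (1 - A * B * D * (p * x * w)) * (1 - D * w)"
      using nz nz1[of n] unfolding T_def U_def d
      by (simp add: qpoch_Suc[of A] qpoch_Suc[of B] qpoch_Suc[of p p n] qpoch_Suc[of D]
            qpoch_Suc[of "A * B * D * (p * p ^ s)"] y
            x_def w_def divide_simps)
    have IH: "(\<Sum>j\<le>s. T (Suc n) j) - (1 - B * D * p ^ n) * (1 - A * D * p ^ n) * (\<Sum>j\<le>s. T n j)
        = - T n s * D * (p * w) * (1 - A * x) * (1 - B * x)"
      using Suc by (simp add: d x_def w_def)
    have "1 * T (Suc n) (Suc s) - (1 - B * D * p ^ n) * (1 - A * D * p ^ n) * T n (Suc s)
          + (- T n s * D * (p * w) * (1 - A * x) * (1 - B * x))
        = - T n (Suc s) * D * w * (1 - A * (p * x)) * (1 - B * (p * x))"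
      unfolding T1 T2 T3 y by algebra
    from creative_telescoping_step[OF _ this, of "sum (T (Suc n)) {..s}" "sum (T n) {..s}"] IH
    show ?case by (simp add: d x_def w_def mult_ac)
  qed
  have "(\<Sum>j\<le>n. T n j) = qpoch (B * D) p n * qpoch (A * D) p n"
  proof (induction n)
    case (Suc n)
    have "T (Suc n) (Suc n) = T n n * D * (1 - A * p ^ n) * (1 - B * p ^ n)"
      using nz by (simp add: T_def qpoch_Suc[of A] qpoch_Suc[of B])
    hence "(\<Sum>j\<le>Suc n. T (Suc n) j) = (1 - B * D * p ^ n) * (1 - A * D * p ^ n) * (\<Sum>j\<le>n. T n j)"
      using partial[of n n] by (simp add: diff_eq_eq)
    thus ?case by (simp add: Suc qpoch_Suc mult_ac)
  qed (simp add: T_def)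
  thus ?thesis by (simp add: T_def)
qed

section \<open>A Bailey pair in base q^2\<close>

locale generic_q =
  fixes q :: "'a::field"
  assumes q_nonzero: "q \<noteq> 0"
    and q_power: "k > 0 \<Longrightarrow> q ^ k \<noteq> 1"
begin

text \<open>Multiplied by \<open>(1 - q ^ (4 * r + 1)) / (1 - q)\<close>, this is alpha_r of the
  Bailey pair below. The very-well-poised factor is kept out so that consecutive values have a
  factored ratio.\<close>

definition bailey_weight :: "nat \<Rightarrow> 'a" where
  "bailey_weight r = qpoch q (q\<^sup>2) r ^ 3 / qpoch (q\<^sup>2) (q\<^sup>2) r ^ 3 * (-1) ^ r * q ^ (r\<^sup>2)"

lemma q_power_mult: "q * q ^ k \<noteq> 1"
  using q_power[of "Suc k"] by simp

lemma qpoch_q_nonzero [simp]: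
  "qpoch q (q\<^sup>2) k \<noteq> 0" "qpoch (q\<^sup>2) (q\<^sup>2) k \<noteq> 0"
proof -
  show "qpoch q (q\<^sup>2) k \<noteq> 0"
    by (intro qpoch_nonzero) (metis power_mult q_power_mult)
  show "qpoch (q\<^sup>2) (q\<^sup>2) k \<noteq> 0"
    by (intro qpoch_nonzero) (metis power_mult power_add q_power add_pos_nonneg zero_less_numeral zero_le)
qed

lemma bailey_weight_Suc:
  "bailey_weight (Suc r) * (1 - q ^ (2 * r + 2)) ^ 3 =
     - bailey_weight r * (1 - q ^ (2 * r + 1)) ^ 3 * q ^ (2 * r + 1)"
proof -
  have nz: "(1 - q\<^sup>2 * q ^ (2 * r)) ^ 3 \<noteq> 0"
    using q_power[of "2 * r + 2"] by (simp add: power2_eq_square mult_ac)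
  have x: "(q\<^sup>2) ^ r = q ^ (2 * r)" "(Suc r)\<^sup>2 = r\<^sup>2 + (2 * r + 1)"
    by (simp_all add: power_mult power2_eq_square)
  have "bailey_weight (Suc r) * (1 - q\<^sup>2 * q ^ (2 * r)) ^ 3 =
     - bailey_weight r * (1 - q * q ^ (2 * r)) ^ 3 * q ^ (2 * r + 1)"
    using nz by (simp add: bailey_weight_def qpoch_Suc x power_mult_distrib
        power_add[of q "r\<^sup>2"] mult_ac)
  thus ?thesis by (simp add: power2_eq_square mult_ac)
qed

text \<open>
  This is the Bailey pair relative to \<open>a = q\<close> in base \<open>q\<^sup>2\<close> obtained from the unit pair with both
  parameters equal to \<open>q\<close>; the usual denominator \<open>(a q\<^sup>2; q\<^sup>2)\<^bsub>m+r\<^esub>\<close> has absorbed the factor \<open>1 - q\<close>.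
\<close>
lemma bailey_pair:
  "(\<Sum>r\<le>m. (1 - q ^ (4 * r + 1)) * bailey_weight r /
       (qpoch (q\<^sup>2) (q\<^sup>2) (m - r) * qpoch q (q\<^sup>2) (m + r + 1)))
     = qpoch q (q\<^sup>2) m / qpoch (q\<^sup>2) (q\<^sup>2) m ^ 3"
proof -
  define E where "E m r = (1 - q ^ (4 * r + 1)) * bailey_weight r /
    (qpoch (q\<^sup>2) (q\<^sup>2) (m - r) * qpoch q (q\<^sup>2) (m + r + 1))" for m r
  have nz: "1 - q ^ k \<noteq> 0" if "k > 0" for k
    using q_power[OF that] by simp
  have p_Suc: "qpoch (q\<^sup>2) (q\<^sup>2) (Suc k) = qpoch (q\<^sup>2) (q\<^sup>2) k * (1 - q ^ (2 * k + 2))" for k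
    by (simp add: qpoch_Suc power2_eq_square power_mult_distrib mult_ac power_mult)
  have q_Suc: "qpoch q (q\<^sup>2) (Suc k) = qpoch q (q\<^sup>2) k * (1 - q ^ (2 * k + 1))" for k
    by (simp add: qpoch_Suc power_mult)
  \<comment> \<open>Creative telescoping in \<open>m\<close>; the two coefficients come from the
    ratio of consecutive closed forms. At \<open>s = m\<close> the certificate is again minus the
    missing last term.\<close>
  have partial: "(1 - q ^ (2 * m + 2)) ^ 3 * (\<Sum>r\<le>s. E (Suc m) r) - (1 - q ^ (2 * m + 1)) * (\<Sum>r\<le>s. E m r)
      = bailey_weight s * (1 - q ^ (2 * s + 1)) ^ 3 * q ^ (2 * m + 1) /
          (qpoch (q\<^sup>2) (q\<^sup>2) (m - s) * qpoch q (q\<^sup>2) (m + s + 2))" if "s \<le> m" for m s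
    using that
  proof (induction s)
    case 0
    define V y where "V = 1 / (qpoch (q\<^sup>2) (q\<^sup>2) (Suc m) * qpoch q (q\<^sup>2) (Suc (Suc m)))" and "y = q ^ (2 * m)"
    have y: "q ^ (2 * m + 2) = q\<^sup>2 * y" "q ^ (2 * m + 1) = q * y" "q ^ (2 * Suc m + 1) = q ^ 3 * y"
      unfolding y_def power_add[symmetric] power_Suc[symmetric] by (rule arg_cong[where f = "power q"], simp)+
    have idx: "m + 0 + 1 = Suc m" by simp_all
    have y_nz: "1 - q\<^sup>2 * y \<noteq> 0" "1 - q ^ 3 * y \<noteq> 0"
      using nz[of "2 * m + 2"] nz[of "2 * Suc m + 1"] unfolding y by simp_all
    have 1: "E (Suc m) 0 = (1 - q) * V"
      by (simp add: E_def V_def bailey_weight_def)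
    have 2: "E m 0 = (1 - q) * (1 - q\<^sup>2 * y) * (1 - q ^ 3 * y) * V"
      using y_nz unfolding E_def V_def bailey_weight_def p_Suc q_Suc[of "Suc m"] idx y by simp
    have 3: "c / (qpoch (q\<^sup>2) (q\<^sup>2) m * qpoch q (q\<^sup>2) (Suc (Suc m))) = c * ((1 - q\<^sup>2 * y) * V)" for c
      using y_nz unfolding V_def p_Suc y by simp
    have "(1 - q\<^sup>2 * y) ^ 3 * ((1 - q) * V) - (1 - q * y) * ((1 - q) * (1 - q\<^sup>2 * y) * (1 - q ^ 3 * y) * V)
       = (1 - q) ^ 3 * (q * y) * ((1 - q\<^sup>2 * y) * V)"
      by algebra
    thus ?case
      unfolding y by (simp add: 1 2 3 bailey_weight_def)
  next
    case (Suc s)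
    then obtain d where m: "m = Suc (s + d)" by (metis add_Suc le_Suc_ex)
    \<comment> \<open>\<open>V\<close> is the reciprocal of a common denominator, and
      \<open>y\<close> below is \<open>q ^ (2 * m)\<close>. Expressing the weight at
      \<open>s\<close> through \<open>b\<close>, its successor, by \<open>bailey_weight_Suc\<close>
      turns the step into a polynomial identity.\<close>
    define V x z b where "V = 1 / (qpoch (q\<^sup>2) (q\<^sup>2) (Suc d) * qpoch q (q\<^sup>2) (Suc (Suc (Suc (m + s)))))"
      and "x = q ^ (2 * s)" and "z = q ^ (2 * d)" and "b = bailey_weight (Suc s)"
    define y where "y = q\<^sup>2 * x * z"
    have pow: "q ^ (2 * m + 2) = q\<^sup>2 * y" "q ^ (2 * m + 1) = q * y" "q ^ (2 * s + 2) = q\<^sup>2 * x"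
      "q ^ (2 * s + 1) = q * x" "q ^ (2 * Suc s + 1) = q ^ 3 * x" "q ^ (4 * Suc s + 1) = q ^ 5 * x\<^sup>2"
      "q ^ (2 * d + 2) = q\<^sup>2 * z" "q ^ (2 * Suc (Suc (m + s)) + 1) = q ^ 5 * x * y"
      unfolding y_def x_def z_def power_add[symmetric] power_mult[symmetric] power_Suc[symmetric]
      by (rule arg_cong[where f = "power q"], simp add: m)+
    have V_nz: "1 - q\<^sup>2 * z \<noteq> 0" "1 - q ^ 5 * x * y \<noteq> 0"
      using nz[of "2 * d + 2"] nz[of "2 * Suc (Suc (m + s)) + 1"] unfolding pow by simp_all
    have d: "m - s = Suc d" "m - Suc s = d" "Suc m - Suc s = Suc d" by (auto simp: m)
    have idx: "m + s + 2 = Suc (Suc (m + s))" "m + Suc s + 2 = Suc (Suc (Suc (m + s)))"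
      "m + Suc s + 1 = Suc (Suc (m + s))" "Suc m + Suc s + 1 = Suc (Suc (Suc (m + s)))"
      by simp_all
    have 1: "E (Suc m) (Suc s) = (1 - q ^ 5 * x\<^sup>2) * b * V"
      unfolding E_def V_def b_def d idx pow by simp
    have 2: "E m (Suc s) = (1 - q ^ 5 * x\<^sup>2) * b * (1 - q\<^sup>2 * z) * (1 - q ^ 5 * x * y) * V"
      unfolding E_def V_def b_def d idx pow p_Suc q_Suc[of "Suc (Suc (m + s))"] using V_nz by simp
    have "- (b * (1 - q\<^sup>2 * x) ^ 3) * (q\<^sup>2 * z) = bailey_weight s * (1 - q * x) ^ 3 * (q * y)"
      using bailey_weight_Suc[of s] unfolding b_def[symmetric] pow y_def by simp
    hence 3: "bailey_weight s * (1 - q * x) ^ 3 * (q * y) /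
          (qpoch (q\<^sup>2) (q\<^sup>2) (m - s) * qpoch q (q\<^sup>2) (m + s + 2))
        = - (b * (1 - q\<^sup>2 * x) ^ 3) * (q\<^sup>2 * z) * (1 - q ^ 5 * x * y) * V"
      unfolding E_def V_def d idx pow q_Suc[of "Suc (Suc (m + s))"] using V_nz by simp
    have 4: "b * (1 - q ^ 3 * x) ^ 3 * (q * y) /
          (qpoch (q\<^sup>2) (q\<^sup>2) (m - Suc s) * qpoch q (q\<^sup>2) (m + Suc s + 2))
        = b * (1 - q ^ 3 * x) ^ 3 * (q * y) * (1 - q\<^sup>2 * z) * V"
      unfolding E_def V_def d idx pow p_Suc using V_nz by simp
    have *: "(1 - q\<^sup>2 * y) ^ 3 * ((1 - q ^ 5 * x\<^sup>2) * b * V)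
        - (1 - q * y) * ((1 - q ^ 5 * x\<^sup>2) * b * (1 - q\<^sup>2 * z) * (1 - q ^ 5 * x * y) * V)
        + (- (b * (1 - q\<^sup>2 * x) ^ 3) * (q\<^sup>2 * z) * (1 - q ^ 5 * x * y) * V)
        = b * (1 - q ^ 3 * x) ^ 3 * (q * y) * (1 - q\<^sup>2 * z) * V"
      unfolding y_def by algebra
    have "s \<le> m" using Suc.prems by simp
    note IH = Suc.IH[OF this, unfolded pow 3]
    show ?case
      unfolding sum.atMost_Suc pow 4[unfolded b_def] 1 2
      using creative_telescoping_step[OF IH *] unfolding b_def .
  qed
  have "(\<Sum>r\<le>m. E m r) = qpoch q (q\<^sup>2) m / qpoch (q\<^sup>2) (q\<^sup>2) m ^ 3"
  proof (induction m)
    case 0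
    show ?case using nz[of 1] by (simp add: E_def bailey_weight_def qpoch_Suc)
  next
    case (Suc m)
    have idx: "Suc m + Suc m + 1 = Suc (Suc (Suc (m + m)))" "m + m + 2 = Suc (Suc (m + m))"
      "2 * Suc (Suc (m + m)) + 1 = 4 * Suc m + 1" by simp_all
    have "(1 - q ^ (2 * m + 2)) ^ 3 * E (Suc m) (Suc m)
       = (bailey_weight (Suc m) * (1 - q ^ (2 * m + 2)) ^ 3) / qpoch q (q\<^sup>2) (Suc (Suc (m + m)))"
      using nz[of "4 * Suc m + 1"] unfolding E_def idx q_Suc[of "Suc (Suc (m + m))"] by simp
    hence "(1 - q ^ (2 * m + 2)) ^ 3 * E (Suc m) (Suc m)
       = - (bailey_weight m * (1 - q ^ (2 * m + 1)) ^ 3 * q ^ (2 * m + 1) /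
          (qpoch (q\<^sup>2) (q\<^sup>2) (m - m) * qpoch q (q\<^sup>2) (m + m + 2)))"
      unfolding bailey_weight_Suc idx by simp
    hence "(1 - q ^ (2 * m + 2)) ^ 3 * (\<Sum>r\<le>Suc m. E (Suc m) r) = (1 - q ^ (2 * m + 1)) * (\<Sum>r\<le>m. E m r)"
      using partial[of m m] by (simp add: diff_eq_eq distrib_left)
    thus ?case using nz[of "2 * m + 2"]
      by (simp add: Suc p_Suc q_Suc divide_simps) (simp add: mult_ac power_mult_distrib)
  qed
  thus ?thesis by (simp add: E_def)
qed

section \<open>A finite form of Bailey's lemma\<close>

lemma q_power_inj: "q ^ a = q ^ b \<Longrightarrow> a = b"
proof (induction a b rule: linorder_wlog)
  case (le a b)
  have "q ^ b = q ^ a * q ^ (b - a)"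
    using le by (metis le_add_diff_inverse power_add)
  hence "q ^ (b - a) = 1"
    using le q_nonzero by simp
  thus ?case using le q_power[of "b - a"] by (cases "b - a = 0") auto
qed (simp add: eq_commute)

lemma qpoch_divide_power_reverse:
  "p \<noteq> 0 \<Longrightarrow> qpoch (x / p ^ N) p N = (\<Prod>i<N. 1 - x / p ^ Suc i)" for x p :: 'a
proof -
  assume "p \<noteq> 0"
  have "qpoch (x / p ^ N) p N = (\<Prod>i<N. 1 - x / p ^ N * p ^ (N - Suc i))"
    unfolding qpoch_def by (subst prod.nat_diff_reindex[symmetric]) simp
  also have "\<dots> = (\<Prod>i<N. 1 - x / p ^ Suc i)"
  proof (intro prod.cong refl)
    fix i assume "i \<in> {..<N}"
    hence "p ^ N = p ^ Suc i * p ^ (N - Suc i)"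
      by (simp flip: power_add power_Suc)
    thus "1 - x / p ^ N * p ^ (N - Suc i) = 1 - x / p ^ Suc i"
      using \<open>p \<noteq> 0\<close> by simp
  qed
  finally show ?thesis .
qed

text \<open>Up to signs and powers of \<open>q\<close>, the factors of
  \<open>(q^(-2N); q^2)_r\<close> are those of \<open>(q^2; q^2)_N / (q^2; q^2)_(N-r)\<close>. The
  left side is what the Bailey weight and the kernel produce, the right side what the Watson sum
  contains.\<close>

lemma qpoch_inverse_power:
  assumes "r \<le> N"
  shows "(-1) ^ r * q ^ (r\<^sup>2) * (1 / (q\<^sup>2) ^ N) ^ r * qpoch (q\<^sup>2) (q\<^sup>2) N / qpoch (q\<^sup>2) (q\<^sup>2) (N - r)
         = q ^ r * qpoch (1 / (q\<^sup>2) ^ N) (q\<^sup>2) r"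
  using assms
proof (induction r)
  case (Suc r)
  then obtain d where N: "N = Suc (r + d)" by (metis add_Suc le_Suc_ex)
  have d: "N - Suc r = d" "N - r = Suc d" by (auto simp: N)
  have nz: "1 - q\<^sup>2 * (q\<^sup>2) ^ d \<noteq> 0"
    using q_power[of "2 * d + 2"] by (simp add: power_mult power2_eq_square power_mult_distrib mult_ac)
  have "q ^ ((Suc r)\<^sup>2) = q ^ (r\<^sup>2) * (q * (q\<^sup>2) ^ r)"
    by (simp add: power2_eq_square power_add power_mult power_mult_distrib)
  hence "(-1) ^ Suc r * q ^ ((Suc r)\<^sup>2) * (1 / (q\<^sup>2) ^ N) ^ Suc r * qpoch (q\<^sup>2) (q\<^sup>2) N / qpoch (q\<^sup>2) (q\<^sup>2) d
      = ((-1) ^ r * q ^ (r\<^sup>2) * (1 / (q\<^sup>2) ^ N) ^ r * qpoch (q\<^sup>2) (q\<^sup>2) N / qpoch (q\<^sup>2) (q\<^sup>2) (Suc d))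
        * (- (q * (q\<^sup>2) ^ r * (1 - q\<^sup>2 * (q\<^sup>2) ^ d) * (1 / (q\<^sup>2) ^ N)))"
    using nz by (simp add: qpoch_Suc[of _ _ d] mult_ac)
  also have "\<dots> = q ^ r * qpoch (1 / (q\<^sup>2) ^ N) (q\<^sup>2) r * (- (q * (q\<^sup>2) ^ r * (1 - q\<^sup>2 * (q\<^sup>2) ^ d) * (1 / (q\<^sup>2) ^ N)))"
    using Suc by (simp add: d)
  also have "(q\<^sup>2) ^ r * (q\<^sup>2 * (q\<^sup>2) ^ d) = (q\<^sup>2) ^ N"
    by (simp add: N power_add)
  hence "- (q * (q\<^sup>2) ^ r * (1 - q\<^sup>2 * (q\<^sup>2) ^ d) * (1 / (q\<^sup>2) ^ N)) = q * (1 - 1 / (q\<^sup>2) ^ N * (q\<^sup>2) ^ r)"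
    using q_nonzero by (simp add: field_simps)
  finally show ?case by (simp add: d qpoch_Suc[of _ _ r] mult_ac)
qed simp

text \<open>Trades the subscripts \<open>N - j\<close> for \<open>j\<close> at the price of a factor
  independent of \<open>j\<close>. This brings the weights of Bailey's lemma into the shape of the
  right-hand side of \<open>watson_special\<close>.\<close>

lemma qpoch_inverse_power_complement:
  assumes "j \<le> N"
  shows "qpoch (1 / (q\<^sup>2) ^ N) (q\<^sup>2) (N - j) * (1 / (q\<^sup>2) ^ N) ^ j / qpoch (q\<^sup>2) (q\<^sup>2) (N - j)
         = qpoch (1 / (q\<^sup>2) ^ N) (q\<^sup>2) N / qpoch (q\<^sup>2) (q\<^sup>2) N *
           ((q\<^sup>2) ^ j * qpoch (1 / (q\<^sup>2) ^ N) (q\<^sup>2) j / qpoch (q\<^sup>2) (q\<^sup>2) j)"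
  using assms
proof (induction j)
  case (Suc j)
  then obtain d where N: "N = Suc (j + d)" by (metis add_Suc le_Suc_ex)
  have d: "N - Suc j = d" "N - j = Suc d" by (auto simp: N)
  define P D where "P = q\<^sup>2" and "D = 1 / P ^ N"
  have P_nz: "P \<noteq> 0" using q_nonzero by (simp add: P_def)
  have nz: "1 - P * P ^ k \<noteq> 0" for k
    using q_power[of "2 * k + 2"] by (simp add: P_def power_mult power2_eq_square power_mult_distrib mult_ac)
  have N': "P ^ N = P * P ^ j * P ^ d" by (simp add: N power_add)
  have D: "1 - D * P ^ d = - (1 - P * P ^ j) / (P * P ^ j)" "1 - D * P ^ j = - (1 - P * P ^ d) / (P * P ^ d)"
    using P_nz by (simp_all add: D_def N' field_simps)
  have "qpoch D P d * D ^ Suc j / qpoch P P d =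
      qpoch D P (Suc d) * D ^ j / qpoch P P (Suc d) * ((1 - P * P ^ d) * D / (1 - D * P ^ d))"
    using nz P_nz by (simp add: qpoch_Suc[of _ _ d] D divide_simps)
  also have "(1 - P * P ^ d) * D / (1 - D * P ^ d) = P * (1 - D * P ^ j) / (1 - P * P ^ j)"
    unfolding D using P_nz nz by (simp add: D_def N' divide_simps) (simp add: algebra_simps)
  also have "qpoch D P (Suc d) * D ^ j / qpoch P P (Suc d) =
      qpoch D P N / qpoch P P N * (P ^ j * qpoch D P j / qpoch P P j)"
    using Suc by (simp add: d P_def D_def)
  finally show ?case
    using nz unfolding d P_def[symmetric] D_def[symmetric] by (simp add: qpoch_Suc[of _ _ j] mult_ac)
qed simp

text \<open>Holds factor by factor once the two products with negative powers are reversed. It is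
  the source of the division by \<open>q ^ N\<close> in \<open>watson_special\<close>.\<close>

lemma qpoch_inverse_power_ratio:
  "qpoch q (q\<^sup>2) N * qpoch (1 / (q\<^sup>2) ^ N) (q\<^sup>2) N * q ^ N =
     qpoch (q\<^sup>2) (q\<^sup>2) N * qpoch (q / (q\<^sup>2) ^ N) (q\<^sup>2) N"
proof -
  have "(1 - q * (q\<^sup>2) ^ i) * (1 - 1 / (q\<^sup>2) ^ Suc i) * q = (1 - q\<^sup>2 * (q\<^sup>2) ^ i) * (1 - q / (q\<^sup>2) ^ Suc i)"
    for i
    using q_nonzero by (simp add: field_simps power2_eq_square)
  hence "(\<Prod>i<N. (1 - q * (q\<^sup>2) ^ i) * (1 - 1 / (q\<^sup>2) ^ Suc i) * q) =
      (\<Prod>i<N. (1 - q\<^sup>2 * (q\<^sup>2) ^ i) * (1 - q / (q\<^sup>2) ^ Suc i))"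
    by simp
  thus ?thesis
    using q_nonzero by (simp add: qpoch_divide_power_reverse prod.distrib) (simp add: qpoch_def)
qed

text \<open>A zero factor would equate an odd with an even power of \<open>q\<close>.\<close>

lemma qpoch_q_divide_power_nonzero: "qpoch (q / (q\<^sup>2) ^ N) (q\<^sup>2) k \<noteq> 0"
proof (intro qpoch_nonzero notI)
  fix i assume "q / (q\<^sup>2) ^ N * (q\<^sup>2) ^ i = 1"
  hence "(q\<^sup>2) ^ i * q = (q\<^sup>2) ^ N"
    using q_nonzero by (simp add: field_simps)
  hence "q ^ (2 * i + 1) = q ^ (2 * N)"
    by (simp only: power_add power_mult power_one_right)
  from q_power_inj[OF this] show False by presburger
qed

text \<open>The inner sum of Bailey's lemma for \<open>a = q\<close> in base \<open>q^2\<close> with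
  parameters \<open>q\<close> and \<open>q^(2N+2)\<close>; \<open>a q^2\<close> divided by their
  product is \<open>q^(-2N)\<close>. After the shift \<open>j = r + i\<close> it is
  \<open>q_saalschuetz\<close> for \<open>n = N - r\<close>, \<open>A = q^(2r+1)\<close>,
  \<open>B = q^(2N+2r+2)\<close>, \<open>D = q^(-2N)\<close>.\<close>

lemma bailey_lemma_kernel:
  assumes "r \<le> N"
  shows "(\<Sum>j=r..N. qpoch q (q\<^sup>2) j * qpoch ((q\<^sup>2) ^ Suc N) (q\<^sup>2) j * qpoch (1 / (q\<^sup>2) ^ N) (q\<^sup>2) (N - j) *
            (1 / (q\<^sup>2) ^ N) ^ j / qpoch (q\<^sup>2) (q\<^sup>2) (N - j) /
            (qpoch (q\<^sup>2) (q\<^sup>2) (j - r) * qpoch q (q\<^sup>2) (j + r + 1))) =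
         (1 / (q\<^sup>2) ^ N) ^ r * qpoch q (q\<^sup>2) r * qpoch ((q\<^sup>2) ^ Suc N) (q\<^sup>2) r /
            (qpoch (q\<^sup>2) (q\<^sup>2) r * qpoch (q / (q\<^sup>2) ^ N) (q\<^sup>2) r) /
            (qpoch (q\<^sup>2) (q\<^sup>2) (N - r) * qpoch q (q\<^sup>2) (N + r + 1)) *
            (qpoch (q\<^sup>2) (q\<^sup>2) N * qpoch (q / (q\<^sup>2) ^ N) (q\<^sup>2) N)"
proof -
  define P D n where "P = q\<^sup>2" and "D = 1 / P ^ N" and "n = N - r"
  have N: "N = r + n" using assms by (simp add: n_def)
  have P_nz: "P \<noteq> 0" using q_nonzero by (simp add: P_def)
  have P_pow: "P ^ k \<noteq> 1" if "k > 0" for k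
    using q_power[of "2 * k"] that by (simp add: P_def power_mult)
  have nz: "qpoch q P k \<noteq> 0" "qpoch P P k \<noteq> 0" "qpoch (q / P ^ N) P k \<noteq> 0" for k
    using qpoch_q_divide_power_nonzero by (simp_all add: P_def)
  define c where "c = qpoch q P r * qpoch (P ^ Suc N) P r * D ^ r / (qpoch P P n * qpoch q P (N + r + 1))"
  have "(\<Sum>j=r..N. qpoch q P j * qpoch (P ^ Suc N) P j * qpoch D P (N - j) * D ^ j / qpoch P P (N - j) /
            (qpoch P P (j - r) * qpoch q P (j + r + 1)))
      = (\<Sum>i\<le>n. qpoch q P (r + i) * qpoch (P ^ Suc N) P (r + i) * qpoch D P (n - i) * D ^ (r + i) /
            qpoch P P (n - i) / (qpoch P P i * qpoch q P (r + i + r + 1)))"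
    by (rule sum.reindex_bij_witness[of _ "\<lambda>i. r + i" "\<lambda>j. j - r"]) (use assms in \<open>auto simp: n_def\<close>)
  also have "\<dots> = (\<Sum>i\<le>n. c * (qpoch P P n / (qpoch P P i * qpoch P P (n - i)) * qpoch (q * P ^ r) P i *
      qpoch (P ^ Suc N * P ^ r) P i * qpoch (q * P ^ r * (P ^ Suc N * P ^ r) * D * P ^ i) P (n - i) *
      qpoch D P (n - i) * D ^ i))"
  proof (intro sum.cong refl)
    fix i assume "i \<in> {..n}"
    hence *: "N + r + 1 = r + i + r + 1 + (n - i)" by (simp add: N)
    \<comment> \<open>The Saalschuetz parameter starts exactly where
      \<open>qpoch q P (r + i + r + 1)\<close> stops, so the two join to
      \<open>qpoch q P (N + r + 1)\<close>.\<close>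
    have arg: "q * P ^ r * (P ^ Suc N * P ^ r) * D * P ^ i = q * P ^ (r + i + r + 1)"
      using P_nz by (simp add: D_def power_add mult_ac)
    have "qpoch (q * P ^ (r + i + r + 1)) P (n - i) / qpoch q P (N + r + 1) = 1 / qpoch q P (r + i + r + 1)"
      unfolding * qpoch_add[of q P "r + i + r + 1"]
      using nz(1)[of "r + i + r + 1 + (n - i)"] unfolding qpoch_add[of q P "r + i + r + 1"] by simp
    thus "qpoch q P (r + i) * qpoch (P ^ Suc N) P (r + i) * qpoch D P (n - i) * D ^ (r + i) /
            qpoch P P (n - i) / (qpoch P P i * qpoch q P (r + i + r + 1)) =
      c * (qpoch P P n / (qpoch P P i * qpoch P P (n - i)) * qpoch (q * P ^ r) P i *
      qpoch (P ^ Suc N * P ^ r) P i * qpoch (q * P ^ r * (P ^ Suc N * P ^ r) * D * P ^ i) P (n - i) *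
      qpoch D P (n - i) * D ^ i)"
      unfolding arg c_def qpoch_add[of q P r i] qpoch_add[of "P ^ Suc N" P r i] power_add[of D]
      using nz by (simp add: divide_simps)
  qed
  also have "\<dots> = c * (qpoch (P ^ Suc N * P ^ r * D) P n * qpoch (q * P ^ r * D) P n)"
    unfolding sum_distrib_left[symmetric] using q_saalschuetz[OF P_pow] by simp
  also have "P ^ Suc N * P ^ r * D = P * P ^ r"
    using P_nz by (simp add: D_def)
  also have "q * P ^ r * D = q / P ^ N * P ^ r"
    by (simp add: D_def)
  also have "qpoch (P * P ^ r) P n = qpoch P P N / qpoch P P r"
    using nz by (simp add: N qpoch_add)
  also have "qpoch (q / P ^ N * P ^ r) P n = qpoch (q / P ^ N) P N / qpoch (q / P ^ N) P r"
    using nz(3)[of r] qpoch_add[of "q / P ^ N" P r n] by (simp add: N)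
  finally show ?thesis
    unfolding P_def[symmetric] D_def[symmetric] n_def[symmetric] c_def by (simp add: mult_ac)
qed

text \<open>For \<open>m = 2N+1\<close> the two special parameters are \<open>q^(1+m)\<close> and
  \<open>q^(1-m)\<close>. In a double sum over \<open>r \<le> j \<le> N\<close>, summing first over
  \<open>j\<close> by \<open>bailey_lemma_kernel\<close> gives the left side, and summing first over
  \<open>r\<close> by \<open>bailey_pair\<close> gives the right side.\<close>

lemma watson_special:
  "(\<Sum>r\<le>N. (1 - q ^ (4 * r + 1)) * qpoch q (q\<^sup>2) r ^ 4 * qpoch ((q\<^sup>2) ^ Suc N) (q\<^sup>2) r *
        qpoch (1 / (q\<^sup>2) ^ N) (q\<^sup>2) r / (qpoch (q\<^sup>2) (q\<^sup>2) r ^ 4 * qpoch (q / (q\<^sup>2) ^ N) (q\<^sup>2) r *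
        qpoch (q * (q\<^sup>2) ^ Suc N) (q\<^sup>2) r) * q ^ r)
   = (1 - q ^ (2 * N + 1)) / q ^ N *
     (\<Sum>j\<le>N. qpoch q (q\<^sup>2) j ^ 2 * qpoch ((q\<^sup>2) ^ Suc N) (q\<^sup>2) j * qpoch (1 / (q\<^sup>2) ^ N) (q\<^sup>2) j /
        qpoch (q\<^sup>2) (q\<^sup>2) j ^ 4 * (q\<^sup>2) ^ j)"
proof -
  define P D where "P = q\<^sup>2" and "D = 1 / P ^ N"
  define a where "a r = (1 - q ^ (4 * r + 1)) * bailey_weight r" for r
  define g where "g j = qpoch q P j * qpoch (P ^ Suc N) P j * qpoch D P (N - j) * D ^ j / qpoch P P (N - j)" for j
  define K where "K = qpoch P P N * qpoch (q / P ^ N) P N"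
  define L where "L r = (1 - q ^ (4 * r + 1)) * qpoch q P r ^ 4 * qpoch (P ^ Suc N) P r *
      qpoch D P r / (qpoch P P r ^ 4 * qpoch (q / P ^ N) P r * qpoch (q * P ^ Suc N) P r) * q ^ r" for r
  define X where "X j = qpoch q P j ^ 2 * qpoch (P ^ Suc N) P j * qpoch D P j / qpoch P P j ^ 4 * P ^ j" for j
  have nz: "qpoch q P k \<noteq> 0" "qpoch P P k \<noteq> 0" "qpoch (q / P ^ N) P k \<noteq> 0" for k
    using qpoch_q_divide_power_nonzero by (simp_all add: P_def)
  have K_nz: "K \<noteq> 0" using nz by (simp add: K_def)
  have "K / (qpoch P P N * qpoch q P (Suc N)) * (\<Sum>r\<le>N. L r) =
      (\<Sum>r\<le>N. a r * (\<Sum>j=r..N. g j / (qpoch P P (j - r) * qpoch q P (j + r + 1))))"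
    unfolding sum_distrib_left[of "K / (qpoch P P N * qpoch q P (Suc N))"]
  proof (intro sum.cong refl)
    fix r assume "r \<in> {..N}"
    hence r: "r \<le> N" by simp
    have LD: "q ^ r * qpoch D P r = (-1) ^ r * q ^ (r\<^sup>2) * D ^ r * qpoch P P N / qpoch P P (N - r)"
      using qpoch_inverse_power[OF r] by (simp add: P_def D_def)
    have "L r = (1 - q ^ (4 * r + 1)) * qpoch q P r ^ 4 * qpoch (P ^ Suc N) P r *
      ((-1) ^ r * q ^ (r\<^sup>2) * D ^ r * qpoch P P N / qpoch P P (N - r)) /
      (qpoch P P r ^ 4 * qpoch (q / P ^ N) P r * qpoch (q * P ^ Suc N) P r)"
      unfolding L_def LD[symmetric] by (simp add: mult_ac)
    moreover have "qpoch q P (N + r + 1) = qpoch q P (Suc N) * qpoch (q * P ^ Suc N) P r"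
      using qpoch_add[of q P "Suc N" r] by simp
    moreover have "(\<Sum>j=r..N. g j / (qpoch P P (j - r) * qpoch q P (j + r + 1))) =
        D ^ r * qpoch q P r * qpoch (P ^ Suc N) P r / (qpoch P P r * qpoch (q / P ^ N) P r) /
        (qpoch P P (N - r) * qpoch q P (N + r + 1)) * K"
      using bailey_lemma_kernel[OF r] by (simp add: P_def D_def g_def K_def)
    ultimately show "K / (qpoch P P N * qpoch q P (Suc N)) * L r =
        a r * (\<Sum>j=r..N. g j / (qpoch P P (j - r) * qpoch q P (j + r + 1)))"
      using nz by (simp add: a_def bailey_weight_def P_def[symmetric] power4_eq_xxxx power3_eq_cube mult_ac)
  qed
  also have "\<dots> = (\<Sum>r\<le>N. \<Sum>j=r..N. g j * (a r / (qpoch P P (j - r) * qpoch q P (j + r + 1))))"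
    by (simp add: sum_distrib_left mult_ac)
  also have "\<dots> = (\<Sum>j\<le>N. \<Sum>r\<le>j. g j * (a r / (qpoch P P (j - r) * qpoch q P (j + r + 1))))"
    unfolding sum.Sigma[OF finite_atMost ballI[OF finite_atLeastAtMost]] sum.Sigma[OF finite_atMost ballI[OF finite_atMost]]
    by (rule sum.reindex_bij_witness[of _ prod.swap prod.swap]) auto
  also have "\<dots> = (\<Sum>j\<le>N. g j * (qpoch q P j / qpoch P P j ^ 3))"
    unfolding sum_distrib_left[symmetric] using bailey_pair by (simp add: a_def P_def)
  also have "\<dots> = qpoch D P N / qpoch P P N * (\<Sum>j\<le>N. X j)"
    unfolding sum_distrib_left
  proof (intro sum.cong refl)
    fix j assume "j \<in> {..N}"
    hence "qpoch D P (N - j) * D ^ j / qpoch P P (N - j) =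
        qpoch D P N / qpoch P P N * (P ^ j * qpoch D P j / qpoch P P j)"
      using qpoch_inverse_power_complement[of j N] by (simp add: P_def D_def)
    hence "g j = qpoch q P j * qpoch (P ^ Suc N) P j * (qpoch D P N / qpoch P P N * (P ^ j * qpoch D P j / qpoch P P j))"
      by (simp add: g_def flip: times_divide_eq_right)
    thus "g j * (qpoch q P j / qpoch P P j ^ 3) = qpoch D P N / qpoch P P N * X j"
      by (simp add: X_def power2_eq_square power3_eq_cube power4_eq_xxxx mult_ac)
  qed
  finally have *: "K / (qpoch P P N * qpoch q P (Suc N)) * (\<Sum>r\<le>N. L r) = qpoch D P N / qpoch P P N * (\<Sum>j\<le>N. X j)" .
  have "K = qpoch q P N * qpoch D P N * q ^ N"
    using qpoch_inverse_power_ratio[of N] by (simp add: K_def P_def D_def)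
  hence D: "qpoch D P N = K / (qpoch q P N * q ^ N)"
    using nz q_nonzero by simp
  have Q: "qpoch q P (Suc N) = qpoch q P N * (1 - q ^ (2 * N + 1))"
    by (simp add: qpoch_Suc P_def power_mult)
  have "1 - q ^ (2 * N + 1) \<noteq> 0"
    using q_power[of "2 * N + 1"] by simp
  hence "(\<Sum>r\<le>N. L r) = qpoch P P N * (qpoch q P N * (1 - q ^ (2 * N + 1))) / K *
      (K / (qpoch P P N * (qpoch q P N * (1 - q ^ (2 * N + 1)))) * (\<Sum>r\<le>N. L r))"
    using nz K_nz by simp
  also have "\<dots> = (1 - q ^ (2 * N + 1)) / q ^ N * (\<Sum>j\<le>N. X j)"
    unfolding *[unfolded Q] D using nz K_nz by simp
  finally have "(\<Sum>r\<le>N. L r) = (1 - q ^ (2 * N + 1)) / q ^ N * (\<Sum>j\<le>N. X j)" .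
  thus ?thesis by (simp only: L_def X_def P_def D_def)
qed

end

subsection \<open>Order of vanishing at a complex point\<close>

lemma to_fract_power: "to_fract (x ^ k) = to_fract x ^ k"
  by (induction k) simp_all

definition poly_at :: "complex \<Rightarrow> rat poly \<Rightarrow> complex" where
  "poly_at \<zeta> p = poly (map_poly of_rat p) \<zeta>"

lemma map_poly_of_rat_1 [simp]: "map_poly of_rat (1 :: rat poly) = (1 :: complex poly)"
  by (simp add: map_poly_1')

lemma map_poly_of_rat_diff:
  "map_poly of_rat (p - q) = (map_poly of_rat p - map_poly of_rat q :: complex poly)"
  by (rule poly_eqI) (simp add: coeff_map_poly of_rat_diff)

lemma map_poly_of_rat_power:
  "map_poly of_rat (p ^ k) = (map_poly of_rat p ^ k :: complex poly)"
  by (induction k) (simp_all add: map_poly_of_rat_mult)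

lemma map_poly_of_rat_qX: "map_poly of_rat qX = ([:0, 1:] :: complex poly)"
  by (simp add: map_poly_pCons)

lemma poly_at_simps [simp]:
  "poly_at \<zeta> 0 = 0" "poly_at \<zeta> 1 = 1" "poly_at \<zeta> qX = \<zeta>"
  "poly_at \<zeta> (p + r) = poly_at \<zeta> p + poly_at \<zeta> r"
  "poly_at \<zeta> (p - r) = poly_at \<zeta> p - poly_at \<zeta> r"
  "poly_at \<zeta> (p * r) = poly_at \<zeta> p * poly_at \<zeta> r"
  by (simp_all add: poly_at_def map_poly_of_rat_add map_poly_of_rat_mult map_poly_of_rat_diff map_poly_of_rat_qX)

lemma coprime_linear_power:
  assumes "poly p a \<noteq> (0 :: complex)"
  shows "coprime ([:-a, 1:] ^ e) p"
proof -
  have "\<not> [:-a, 1:] dvd p"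
    using assms by (simp add: poly_eq_0_iff_dvd)
  hence "coprime [:-a, 1:] p"
    by (intro prime_elem_imp_coprime prime_elem_linear_field_poly) auto
  thus ?thesis by simp
qed

text \<open>The order is at least \<open>e\<close>: \<open>0\<close> vanishes to every order, and
  \<open>e = 0\<close> means that there is no pole. Any representation with a denominator nonzero at
  \<zeta> is allowed, not only the reduced one, which makes closure under sums and products
  direct.\<close>

definition vanishes_at :: "complex \<Rightarrow> nat \<Rightarrow> rat poly fract \<Rightarrow> bool" where
  "vanishes_at \<zeta> e f \<longleftrightarrow> (\<exists>u v. poly_at \<zeta> v \<noteq> 0 \<and>
     [:-\<zeta>, 1:] ^ e dvd (map_poly of_rat u :: complex poly) \<and> f = to_fract u / to_fract v)"

abbreviation regular_at :: "complex \<Rightarrow> rat poly fract \<Rightarrow> bool" where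
  "regular_at \<zeta> \<equiv> vanishes_at \<zeta> 0"

text \<open>Meaningful at regular points, where \<open>value_at_eq\<close> allows any admissible
  denominator. At a pole the value is 0 by the convention for division.\<close>

definition value_at :: "complex \<Rightarrow> rat poly fract \<Rightarrow> complex" where
  "value_at \<zeta> f = poly_at \<zeta> (fst (quot_of_fract f)) / poly_at \<zeta> (snd (quot_of_fract f))"

lemma fract_eq_quot: "f = to_fract (fst (quot_of_fract f)) / to_fract (snd (quot_of_fract f))"
  for f :: "rat poly fract"
  by (simp flip: Fract_conv_to_fract)

text \<open>The reduced denominator divides every other one, and \<open>X - \<zeta>\<close> is
  coprime to the given denominator, so both properties pass to the reduced fraction.\<close>

lemma vanishes_at_quot:
  assumes "vanishes_at \<zeta> e f"
  shows "poly_at \<zeta> (snd (quot_of_fract f)) \<noteq> 0"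
    and "[:-\<zeta>, 1:] ^ e dvd (map_poly of_rat (fst (quot_of_fract f)) :: complex poly)"
proof -
  obtain u v where uv: "poly_at \<zeta> v \<noteq> 0" "[:-\<zeta>, 1:] ^ e dvd (map_poly of_rat u :: complex poly)"
    "f = to_fract u / to_fract v"
    using assms by (auto simp: vanishes_at_def)
  define x y where "x = fst (quot_of_fract f)" and "y = snd (quot_of_fract f)"
  have v: "v \<noteq> 0" and y: "y \<noteq> 0" using uv by (auto simp: y_def)
  have "to_fract x / to_fract y = to_fract u / to_fract v"
    using fract_eq_quot[of f] uv(3) by (simp add: x_def y_def)
  hence "to_fract (x * v) = to_fract (u * y)"
    using v y by (simp add: divide_simps)
  hence eq: "x * v = u * y" by (simp only: to_fract_eq_iff)
  have "coprime x y" by (simp add: x_def y_def coprime_quot_of_fract)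
  hence "y dvd v"
    using eq by (metis coprime_commute coprime_dvd_mult_right_iff dvd_triv_right)
  thus "poly_at \<zeta> (snd (quot_of_fract f)) \<noteq> 0"
    using uv(1) by (auto simp: y_def)
  have "[:-\<zeta>, 1:] ^ e dvd (map_poly of_rat (x * v) :: complex poly)"
    unfolding eq map_poly_of_rat_mult using uv(2) by simp
  moreover have "coprime ([:-\<zeta>, 1:] ^ e) (map_poly of_rat v :: complex poly)"
    using uv(1) by (intro coprime_linear_power) (simp add: poly_at_def)
  ultimately show "[:-\<zeta>, 1:] ^ e dvd (map_poly of_rat (fst (quot_of_fract f)) :: complex poly)"
    unfolding x_def[symmetric] by (simp add: map_poly_of_rat_mult coprime_dvd_mult_left_iff)
qed

lemma value_at_eq:
  assumes "poly_at \<zeta> v \<noteq> 0"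
  shows "value_at \<zeta> (to_fract u / to_fract v) = poly_at \<zeta> u / poly_at \<zeta> v"
proof -
  define f where "f = to_fract u / to_fract v"
  define x y where "x = fst (quot_of_fract f)" and "y = snd (quot_of_fract f)"
  have "regular_at \<zeta> f" using assms by (auto simp: vanishes_at_def f_def)
  hence yz: "poly_at \<zeta> y \<noteq> 0" unfolding y_def by (rule vanishes_at_quot)
  hence v: "v \<noteq> 0" and y: "y \<noteq> 0" using assms by auto
  have "to_fract x / to_fract y = to_fract u / to_fract v"
    using fract_eq_quot[of f] by (simp add: x_def y_def f_def)
  hence "to_fract (x * v) = to_fract (u * y)"
    using v y by (simp add: divide_simps)
  hence "x * v = u * y" by (simp only: to_fract_eq_iff)
  hence "poly_at \<zeta> x * poly_at \<zeta> v = poly_at \<zeta> u * poly_at \<zeta> y"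
    by (metis poly_at_simps(6))
  thus ?thesis
    using assms yz by (simp add: value_at_def flip: f_def x_def y_def) (simp add: field_simps)
qed

lemma vanishes_atE:
  assumes "vanishes_at \<zeta> e f"
  obtains u v where "poly_at \<zeta> v \<noteq> 0" "v \<noteq> 0" "[:-\<zeta>, 1:] ^ e dvd (map_poly of_rat u :: complex poly)"
    "f = to_fract u / to_fract v" "value_at \<zeta> f = poly_at \<zeta> u / poly_at \<zeta> v"
  using assms value_at_eq unfolding vanishes_at_def by (metis poly_at_simps(1))

lemma vanishes_atI:
  assumes "poly_at \<zeta> v \<noteq> 0" "[:-\<zeta>, 1:] ^ e dvd (map_poly of_rat u :: complex poly)"
    "f = to_fract u / to_fract v"
  shows "vanishes_at \<zeta> e f"
  using assms unfolding vanishes_at_def by blast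

lemma vanishes_at_add_value:
  assumes "vanishes_at \<zeta> e f" "vanishes_at \<zeta> e g"
  shows "vanishes_at \<zeta> e (f + g) \<and> value_at \<zeta> (f + g) = value_at \<zeta> f + value_at \<zeta> g"
proof -
  obtain u v where f: "poly_at \<zeta> v \<noteq> 0" "v \<noteq> 0" "[:-\<zeta>, 1:] ^ e dvd (map_poly of_rat u :: complex poly)"
    "f = to_fract u / to_fract v" "value_at \<zeta> f = poly_at \<zeta> u / poly_at \<zeta> v"
    using assms(1) by (rule vanishes_atE)
  obtain u' v' where g: "poly_at \<zeta> v' \<noteq> 0" "v' \<noteq> 0" "[:-\<zeta>, 1:] ^ e dvd (map_poly of_rat u' :: complex poly)"
    "g = to_fract u' / to_fract v'" "value_at \<zeta> g = poly_at \<zeta> u' / poly_at \<zeta> v'"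
    using assms(2) by (rule vanishes_atE)
  have eq: "f + g = to_fract (u * v' + u' * v) / to_fract (v * v')"
    using f(2) g(2) by (simp add: f(4) g(4) add_frac_eq)
  have nz: "poly_at \<zeta> (v * v') \<noteq> 0" using f g by simp
  have "[:-\<zeta>, 1:] ^ e dvd (map_poly of_rat (u * v' + u' * v) :: complex poly)"
    using f g by (simp add: map_poly_of_rat_add map_poly_of_rat_mult)
  with nz have "vanishes_at \<zeta> e (f + g)" using eq by (rule vanishes_atI)
  moreover have "value_at \<zeta> (f + g) = value_at \<zeta> f + value_at \<zeta> g"
    unfolding eq value_at_eq[OF nz] f(5) g(5) using f(1) g(1) by (simp add: add_frac_eq)
  ultimately show ?thesis ..
qed

lemma vanishes_at_mult_value:
  assumes "vanishes_at \<zeta> e f" "vanishes_at \<zeta> e' g"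
  shows "vanishes_at \<zeta> (e + e') (f * g) \<and> value_at \<zeta> (f * g) = value_at \<zeta> f * value_at \<zeta> g"
proof -
  obtain u v where f: "poly_at \<zeta> v \<noteq> 0" "v \<noteq> 0" "[:-\<zeta>, 1:] ^ e dvd (map_poly of_rat u :: complex poly)"
    "f = to_fract u / to_fract v" "value_at \<zeta> f = poly_at \<zeta> u / poly_at \<zeta> v"
    using assms(1) by (rule vanishes_atE)
  obtain u' v' where g: "poly_at \<zeta> v' \<noteq> 0" "v' \<noteq> 0" "[:-\<zeta>, 1:] ^ e' dvd (map_poly of_rat u' :: complex poly)"
    "g = to_fract u' / to_fract v'" "value_at \<zeta> g = poly_at \<zeta> u' / poly_at \<zeta> v'"
    using assms(2) by (rule vanishes_atE)
  have eq: "f * g = to_fract (u * u') / to_fract (v * v')"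
    by (simp add: f(4) g(4))
  have nz: "poly_at \<zeta> (v * v') \<noteq> 0" using f g by simp
  have "[:-\<zeta>, 1:] ^ (e + e') dvd (map_poly of_rat (u * u') :: complex poly)"
    unfolding map_poly_of_rat_mult power_add using f(3) g(3) by (rule mult_dvd_mono)
  with nz have "vanishes_at \<zeta> (e + e') (f * g)" using eq by (rule vanishes_atI)
  moreover have "value_at \<zeta> (f * g) = value_at \<zeta> f * value_at \<zeta> g"
    unfolding eq value_at_eq[OF nz] f(5) g(5) by simp
  ultimately show ?thesis ..
qed

lemmas vanishes_at_add = vanishes_at_add_value[THEN conjunct1]
  and value_at_add = vanishes_at_add_value[THEN conjunct2]
  and vanishes_at_mult = vanishes_at_mult_value[THEN conjunct1]
  and value_at_mult = vanishes_at_mult_value[THEN conjunct2]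

lemma regular_at_to_fract [simp]: "regular_at \<zeta> (to_fract p)"
  by (rule vanishes_atI[of _ 1 _ p]) simp_all

lemma value_at_to_fract [simp]: "value_at \<zeta> (to_fract p) = poly_at \<zeta> p"
  using value_at_eq[of \<zeta> 1 p] by simp

lemma regular_at_1 [simp]: "regular_at \<zeta> 1" and value_at_1 [simp]: "value_at \<zeta> 1 = 1"
  using regular_at_to_fract[of \<zeta> 1] value_at_to_fract[of \<zeta> 1] by simp_all

lemma vanishes_at_0 [simp]: "vanishes_at \<zeta> e 0" and value_at_0 [simp]: "value_at \<zeta> 0 = 0"
  using vanishes_atI[of \<zeta> 1 e 0 0] value_at_to_fract[of \<zeta> 0] by simp_all

lemma regular_at_mult: "regular_at \<zeta> f \<Longrightarrow> regular_at \<zeta> g \<Longrightarrow> regular_at \<zeta> (f * g)"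
  using vanishes_at_mult[of \<zeta> 0 f 0 g] by simp

lemma vanishes_at_mult_left: "regular_at \<zeta> f \<Longrightarrow> vanishes_at \<zeta> e g \<Longrightarrow> vanishes_at \<zeta> e (f * g)"
  using vanishes_at_mult[of \<zeta> 0 f e g] by simp

lemma vanishes_at_mult_right: "vanishes_at \<zeta> e f \<Longrightarrow> regular_at \<zeta> g \<Longrightarrow> vanishes_at \<zeta> e (f * g)"
  using vanishes_at_mult[of \<zeta> e f 0 g] by simp

lemma vanishes_at_mono: "vanishes_at \<zeta> e f \<Longrightarrow> e' \<le> e \<Longrightarrow> vanishes_at \<zeta> e' f"
  unfolding vanishes_at_def using le_imp_power_dvd dvd_trans by metis

lemma vanishes_at_uminus: "vanishes_at \<zeta> e f \<Longrightarrow> vanishes_at \<zeta> e (- f)"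
  using vanishes_at_mult_left[OF regular_at_to_fract[of \<zeta> "-1"], of e f] by simp

lemma vanishes_at_diff: "vanishes_at \<zeta> e f \<Longrightarrow> vanishes_at \<zeta> e g \<Longrightarrow> vanishes_at \<zeta> e (f - g)"
  using vanishes_at_add[of \<zeta> e f "- g"] vanishes_at_uminus[of \<zeta> e g] by simp

lemma value_at_diff:
  "regular_at \<zeta> f \<Longrightarrow> regular_at \<zeta> g \<Longrightarrow> value_at \<zeta> (f - g) = value_at \<zeta> f - value_at \<zeta> g"
  using value_at_add[of \<zeta> 0 "f - g" g] vanishes_at_diff[of \<zeta> 0 f g] by simp

lemma vanishes_at_sum: "(\<And>i. i \<in> A \<Longrightarrow> vanishes_at \<zeta> e (f i)) \<Longrightarrow> vanishes_at \<zeta> e (sum f A)"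
  by (induction A rule: infinite_finite_induct) (auto intro: vanishes_at_add)

lemma value_at_sum:
  "(\<And>i. i \<in> A \<Longrightarrow> regular_at \<zeta> (f i)) \<Longrightarrow> value_at \<zeta> (sum f A) = (\<Sum>i\<in>A. value_at \<zeta> (f i))"
  by (induction A rule: infinite_finite_induct) (auto simp: value_at_add[of _ 0] vanishes_at_sum)

lemma regular_at_prod: "(\<And>i. i \<in> A \<Longrightarrow> regular_at \<zeta> (f i)) \<Longrightarrow> regular_at \<zeta> (prod f A)"
  by (induction A rule: infinite_finite_induct) (auto intro: regular_at_mult)

lemma value_at_prod:
  "(\<And>i. i \<in> A \<Longrightarrow> regular_at \<zeta> (f i)) \<Longrightarrow> value_at \<zeta> (prod f A) = (\<Prod>i\<in>A. value_at \<zeta> (f i))"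
  by (induction A rule: infinite_finite_induct) (auto simp: value_at_mult[of _ 0 _ 0] regular_at_prod)

lemma vanishes_at_power: "vanishes_at \<zeta> e f \<Longrightarrow> vanishes_at \<zeta> (e * k) (f ^ k)"
  by (induction k) (auto intro: vanishes_at_mult)

lemma regular_at_power: "regular_at \<zeta> f \<Longrightarrow> regular_at \<zeta> (f ^ k)"
  using vanishes_at_power[of \<zeta> 0 f k] by simp

lemma value_at_power: "regular_at \<zeta> f \<Longrightarrow> value_at \<zeta> (f ^ k) = value_at \<zeta> f ^ k"
  by (induction k) (auto simp: value_at_mult[of _ 0 _ 0] regular_at_power)

lemma regular_at_inverse: "regular_at \<zeta> f \<Longrightarrow> value_at \<zeta> f \<noteq> 0 \<Longrightarrow> regular_at \<zeta> (1 / f)"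
  and value_at_inverse: "regular_at \<zeta> f \<Longrightarrow> value_at \<zeta> f \<noteq> 0 \<Longrightarrow> value_at \<zeta> (1 / f) = 1 / value_at \<zeta> f"
proof -
  assume f: "regular_at \<zeta> f" "value_at \<zeta> f \<noteq> 0"
  obtain u v where uv: "poly_at \<zeta> v \<noteq> 0" "v \<noteq> 0" "f = to_fract u / to_fract v"
    "value_at \<zeta> f = poly_at \<zeta> u / poly_at \<zeta> v"
    using f(1) by (rule vanishes_atE)
  hence u: "poly_at \<zeta> u \<noteq> 0" using f by auto
  have eq: "1 / f = to_fract v / to_fract u" using uv by simp
  show "regular_at \<zeta> (1 / f)" by (rule vanishes_atI[OF u _ eq]) simp
  show "value_at \<zeta> (1 / f) = 1 / value_at \<zeta> f"
    unfolding eq value_at_eq[OF u] uv(4) by simp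
qed

lemma value_at_divide:
  "regular_at \<zeta> f \<Longrightarrow> regular_at \<zeta> g \<Longrightarrow> value_at \<zeta> g \<noteq> 0 \<Longrightarrow>
     value_at \<zeta> (f / g) = value_at \<zeta> f / value_at \<zeta> g"
  using value_at_mult[of \<zeta> 0 f 0 "1 / g"] regular_at_inverse[of \<zeta> g] value_at_inverse[of \<zeta> g] by simp

lemma vanishes_at_1_iff: "vanishes_at \<zeta> 1 f \<longleftrightarrow> regular_at \<zeta> f \<and> value_at \<zeta> f = 0"
proof
  assume "vanishes_at \<zeta> 1 f"
  then obtain u v where uv: "poly_at \<zeta> v \<noteq> 0" "[:-\<zeta>, 1:] ^ 1 dvd (map_poly of_rat u :: complex poly)"
    "f = to_fract u / to_fract v" "value_at \<zeta> f = poly_at \<zeta> u / poly_at \<zeta> v"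
    by (rule vanishes_atE)
  hence "value_at \<zeta> f = 0" by (simp add: poly_at_def poly_eq_0_iff_dvd)
  thus "regular_at \<zeta> f \<and> value_at \<zeta> f = 0"
    using \<open>vanishes_at \<zeta> 1 f\<close> vanishes_at_mono by blast
next
  assume f: "regular_at \<zeta> f \<and> value_at \<zeta> f = 0"
  then obtain u v where uv: "poly_at \<zeta> v \<noteq> 0"
    "f = to_fract u / to_fract v" "value_at \<zeta> f = poly_at \<zeta> u / poly_at \<zeta> v"
    by (meson vanishes_atE)
  hence "poly_at \<zeta> u = 0" using f by simp
  thus "vanishes_at \<zeta> 1 f"
    by (intro vanishes_atI[OF uv(1) _ uv(2)]) (simp add: poly_at_def poly_eq_0_iff_dvd)
qed

section \<open>From local vanishing to the congruence\<close>

lemma prod_linear_powers_dvd: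
  fixes f :: "complex poly"
  assumes "finite Z" "\<And>z. z \<in> Z \<Longrightarrow> [:-z, 1:] ^ e z dvd f"
  shows "(\<Prod>z\<in>Z. [:-z, 1:] ^ e z) dvd f"
  using assms
proof (induction Z rule: finite_induct)
  case (insert a Z)
  have "poly (\<Prod>z\<in>Z. [:-z, 1:] ^ e z) a \<noteq> 0"
    using insert by (auto simp: poly_prod)
  hence "coprime ([:-a, 1:] ^ e a) (\<Prod>z\<in>Z. [:-z, 1:] ^ e z)"
    by (rule coprime_linear_power)
  thus ?case using insert by (simp add: divides_mult)
qed simp

lemma map_poly_qint_qX:
  assumes "n > 0"
  shows "map_poly of_rat (qint qX n) = (\<Prod>z | z ^ n = 1 \<and> z \<noteq> 1. [:-z, 1:] :: complex poly)"
proof -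
  have fin: "finite {z::complex. z ^ n = 1}" using assms by (simp add: finite_roots_unity)
  have "(qX - 1) * qint qX n = qX ^ n - 1"
    by (simp add: qint_def power_diff_1_eq)
  hence "map_poly of_rat (qX - 1) * map_poly of_rat (qint qX n) = (map_poly of_rat (qX ^ n - 1) :: complex poly)"
    by (simp only: flip: map_poly_of_rat_mult)
  also have "\<dots> = monom 1 n - 1"
    by (simp only: map_poly_of_rat_diff map_poly_of_rat_power map_poly_of_rat_qX map_poly_of_rat_1)
       (simp add: monom_altdef)
  also have "\<dots> = (\<Prod>z | z ^ n = 1. [:-z, 1:])"
    using prod_roots_unity[OF assms] by simp
  also have "\<dots> = [:-1, 1:] * (\<Prod>z\<in>{z. z ^ n = 1} - {1}. [:-z, 1:])"
    using fin by (subst prod.remove[of _ 1]) auto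
  also have "{z. z ^ n = 1} - {1} = {z::complex. z ^ n = 1 \<and> z \<noteq> 1}" by auto
  also have "map_poly of_rat (qX - 1) = ([:-1, 1:] :: complex poly)"
    by (simp only: map_poly_of_rat_diff map_poly_of_rat_qX map_poly_of_rat_1) (simp add: one_pCons)
  finally show ?thesis by (subst (asm) mult_cancel_left) auto
qed

text \<open>Over the complex numbers the modulus is a product of powers of \<open>X - z\<close> over
  the \<open>n\<close>-th roots of unity \<open>z\<close> other than 1, with exponent 3 at the
  primitive ones and 1 elsewhere. These coprime powers divide the reduced numerator, and the
  quotient is again rational by \<open>map_poly_of_rat_divide\<close>.\<close>

lemma ratfun_cong_if_vanishes_at:
  assumes n: "n > 1"
    and van: "\<And>z. z ^ n = 1 \<Longrightarrow> z \<noteq> 1 \<Longrightarrow>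
      vanishes_at z (if z \<in> primitive_roots_unity n then 3 else 1) (A - B)"
  shows "ratfun_cong A B (qint qX n * cyclotomic n ^ 2)"
proof -
  define P where "P = qint qX n * cyclotomic n ^ 2"
  define x y where "x = fst (quot_of_fract (A - B))" and "y = snd (quot_of_fract (A - B))"
  define Z where "Z = {z::complex. z ^ n = 1 \<and> z \<noteq> 1}"
  define e where "e z = (if z \<in> primitive_roots_unity n then 3 else 1 :: nat)" for z
  have fin: "finite Z"
    using finite_roots_unity[of n] n unfolding Z_def by (auto intro: finite_subset[rotated])
  \<comment> \<open>For \<open>n > 1\<close> the number 1 is not a primitive \<open>n\<close>-th
    root, so \<open>Z\<close> contains all of these.\<close>
  have prim: "primitive_roots_unity n = {z \<in> Z. z \<in> primitive_roots_unity n}"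
    using n unfolding Z_def primitive_roots_unity_def by force
  have "map_poly of_rat P = (\<Prod>z\<in>Z. [:-z, 1:]) * (\<Prod>z\<in>primitive_roots_unity n. [:-z, 1:]) ^ 2"
    using n by (simp add: P_def map_poly_of_rat_mult map_poly_of_rat_power map_poly_qint_qX of_rat_cyclotomic Z_def)
  also have "(\<Prod>z\<in>primitive_roots_unity n. [:-z, 1:]) =
      (\<Prod>z\<in>Z. if z \<in> primitive_roots_unity n then [:-z, 1:] else 1)"
    by (subst prim) (simp add: prod.inter_filter[OF fin])
  also have "(\<Prod>z\<in>Z. [:-z, 1:]) * \<dots> ^ 2 = (\<Prod>z\<in>Z. [:-z, 1:] ^ e z)"
    unfolding prod_power_distrib prod.distrib[symmetric] e_def
    by (intro prod.cong) (auto simp: power2_eq_square power3_eq_cube simp del: mult_pCons_left mult_pCons_right)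
  finally have mapP: "map_poly of_rat P = (\<Prod>z\<in>Z. [:-z, 1:] ^ e z)" .
  have P_nz: "P \<noteq> 0" using mapP fin by auto
  have "(map_poly of_rat P :: complex poly) dvd map_poly of_rat x"
    unfolding mapP using fin vanishes_at_quot(2)[OF van]
    by (intro prod_linear_powers_dvd) (auto simp: Z_def e_def x_def)
  then obtain r where r: "map_poly of_rat x = map_poly of_rat P * (r :: complex poly)"
    by (elim dvdE)
  then obtain U where "r = map_poly of_rat U"
    using map_poly_of_rat_divide[OF r P_nz] by blast
  hence x: "x = P * U"
    using r map_poly_of_rat_inj by (metis map_poly_of_rat_mult)
  \<comment> \<open>A nonconstant common divisor would have a complex root. As a root of
    \<open>P\<close> it lies in \<open>Z\<close>, where the reduced denominator is nonzero by
    \<open>van\<close>.\<close>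
  have "coprime y P"
  proof (rule coprimeI)
    fix d assume d: "d dvd y" "d dvd P"
    show "is_unit d"
    proof (rule ccontr)
      assume "\<not> is_unit d"
      moreover have "d \<noteq> 0" using d P_nz by auto
      ultimately have "degree d \<noteq> 0" by (simp add: is_unit_iff_degree)
      hence "\<not> constant (poly (map_poly of_rat d :: complex poly))"
        by (simp add: constant_degree degree_map_poly_of_rat)
      then obtain z where z: "poly_at z d = 0"
        using fundamental_theorem_of_algebra unfolding poly_at_def by blast
      hence "poly_at z P = 0" "poly_at z y = 0" using d by auto
      hence "z \<in> Z"
        unfolding poly_at_def mapP using fin by (auto simp: poly_prod)
      hence "poly_at z y \<noteq> 0"
        unfolding y_def by (intro vanishes_at_quot(1)[OF van]) (auto simp: Z_def)
      thus False using \<open>poly_at z y = 0\<close> by simp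
    qed
  qed
  moreover have "y \<noteq> 0" by (simp add: y_def)
  moreover have "A - B = to_fract P * (to_fract U / to_fract y)"
    using fract_eq_quot[of "A - B"] x by (simp add: x_def y_def)
  ultimately show ?thesis unfolding ratfun_cong_def P_def[symmetric] by blast
qed

section \<open>Congruences in the local ring at a point\<close>

definition unit_at :: "complex \<Rightarrow> rat poly fract \<Rightarrow> bool" where
  "unit_at \<zeta> f \<longleftrightarrow> regular_at \<zeta> f \<and> value_at \<zeta> f \<noteq> 0"

lemma unit_at_nonzero: "unit_at \<zeta> f \<Longrightarrow> f \<noteq> 0"
  by (auto simp: unit_at_def)

lemma unit_at_mult: "unit_at \<zeta> f \<Longrightarrow> unit_at \<zeta> g \<Longrightarrow> unit_at \<zeta> (f * g)"
  by (simp add: unit_at_def regular_at_mult value_at_mult[of _ 0 _ 0])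

lemma unit_at_power: "unit_at \<zeta> f \<Longrightarrow> unit_at \<zeta> (f ^ k)"
  by (simp add: unit_at_def regular_at_power value_at_power)

lemma vanishes_at_divide_unit: "vanishes_at \<zeta> e f \<Longrightarrow> unit_at \<zeta> g \<Longrightarrow> vanishes_at \<zeta> e (f / g)"
  using vanishes_at_mult_right[of \<zeta> e f "1 / g"] regular_at_inverse[of \<zeta> g] by (simp add: unit_at_def)

text \<open>A difference vanishing to order \<open>e\<close> is a congruence modulo the
  \<open>e\<close>-th power of the maximal ideal at \<zeta>; the factors are replaced one at a
  time.\<close>

lemma vanishes_at_mult_diff:
  assumes "vanishes_at \<zeta> e (x - x')" "vanishes_at \<zeta> e (y - y')" "regular_at \<zeta> x" "regular_at \<zeta> y'"
  shows "vanishes_at \<zeta> e (x * y - x' * y')"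
proof -
  have "x * y - x' * y' = x * (y - y') + (x - x') * y'" by (simp add: algebra_simps)
  thus ?thesis
    using assms by (auto intro: vanishes_at_add vanishes_at_mult_left vanishes_at_mult_right)
qed

lemma vanishes_at_prod_diff:
  assumes "\<And>i. i \<in> A \<Longrightarrow> vanishes_at \<zeta> e (f i - g i)"
    and "\<And>i. i \<in> A \<Longrightarrow> regular_at \<zeta> (f i)" "\<And>i. i \<in> A \<Longrightarrow> regular_at \<zeta> (g i)"
  shows "vanishes_at \<zeta> e (prod f A - prod g A)"
  using assms
  by (induction A rule: infinite_finite_induct) (auto intro!: vanishes_at_mult_diff regular_at_prod)

lemma vanishes_at_divide_diff:
  assumes "vanishes_at \<zeta> e (x - x')" "vanishes_at \<zeta> e (y - y')" "regular_at \<zeta> x"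
    "unit_at \<zeta> y" "unit_at \<zeta> y'"
  shows "vanishes_at \<zeta> e (x / y - x' / y')"
proof -
  have "1 / y - 1 / y' = - ((y - y') / (y * y'))"
    using unit_at_nonzero[OF assms(4)] unit_at_nonzero[OF assms(5)] by (simp add: field_simps)
  hence "vanishes_at \<zeta> e (1 / y - 1 / y')"
    using assms by (auto intro: vanishes_at_uminus vanishes_at_divide_unit unit_at_mult)
  moreover have "regular_at \<zeta> (1 / y')"
    using assms(5) by (auto intro: vanishes_at_divide_unit)
  ultimately show ?thesis
    using vanishes_at_mult_diff[OF assms(1) _ assms(3), of "1 / y" "1 / y'"] by simp
qed

subsection \<open>Truncated convolution squares\<close>

text \<open>Summing over a full square turns the truncation into a condition on
  \<open>i + j\<close>. In this form both indices can be split into blocks, or the sum compared with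
  an untruncated square.\<close>

lemma sum_convolution_square:
  fixes f :: "nat \<Rightarrow> 'a::comm_ring_1"
  assumes "n > 0"
  shows "(\<Sum>k=0..n - 1. \<Sum>j=0..k. f j * f (k - j)) = (\<Sum>i<n. \<Sum>j<n. if i + j < n then f i * f j else 0)"
proof -
  have "(\<Sum>k=0..n - 1. \<Sum>j=0..k. f j * f (k - j)) = (\<Sum>k<n. \<Sum>j\<le>k. f j * f (k - j))"
    using assms by (intro sum.cong) auto
  also have "\<dots> = (\<Sum>(i,j)\<in>{(i,j). i + j < n}. f i * f j)"
    by (rule sum.triangle_reindex[symmetric])
  also have "\<dots> = (\<Sum>(i,j)\<in>{..<n} \<times> {..<n}. if i + j < n then f i * f j else 0)"
    by (rule sum.mono_neutral_cong_left) (auto split: if_splits)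
  also have "\<dots> = (\<Sum>i<n. \<Sum>j<n. if i + j < n then f i * f j else 0)"
    by (simp add: sum.cartesian_product)
  finally show ?thesis .
qed

lemma sum_blocks:
  fixes f :: "nat \<Rightarrow> 'a::comm_monoid_add"
  shows "(\<Sum>i<M * m. f i) = (\<Sum>l<M. \<Sum>r<m. f (l * m + r))"
proof -
  have "(\<Sum>l<M. sum f {l * m..<l * m + m}) = sum f {..<M * m}"
    by (rule sum.nat_group)
  moreover have "sum f {l * m..<l * m + m} = (\<Sum>r<m. f (l * m + r))" for l
    by (rule sum.reindex_bij_witness[of _ "\<lambda>r. l * m + r" "\<lambda>i. i - l * m"]) auto
  ultimately show ?thesis by simp
qed

text \<open>Write the indices as \<open>l * m + r\<close> and \<open>k * m + s\<close>. A nonzero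
  term has \<open>2 * r < m\<close> and \<open>2 * s < m\<close>, hence \<open>r + s < m\<close>,
  and the truncation reduces to \<open>l + k < M\<close>. The residues are then unconstrained, and
  the sum over \<open>s\<close> is zero.\<close>

lemma truncated_convolution_square_zero:
  fixes f \<kappa> :: "nat \<Rightarrow> 'a::comm_ring_1"
  assumes block: "\<And>l r. r < m \<Longrightarrow> f (l * m + r) = \<kappa> l * f r"
    and supp: "\<And>r. r < m \<Longrightarrow> m \<le> 2 * r \<Longrightarrow> f r = 0"
    and zero: "(\<Sum>r<m. f r) = 0"
  shows "(\<Sum>i<M * m. \<Sum>j<M * m. if i + j < M * m then f i * f j else 0) = 0"
proof -
  define w where "w l k = (if l + k < M then \<kappa> l * \<kappa> k else 0)" for l k
  have *: "(if l * m + r + (k * m + s) < M * m then f (l * m + r) * f (k * m + s) else 0)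
      = w l k * (f r * f s)" if "r < m" "s < m" for l r k s
  proof (cases "m \<le> 2 * r \<or> m \<le> 2 * s")
    case True
    thus ?thesis using supp that by (auto simp: block)
  next
    case False
    hence rs: "r + s < m" by auto
    have "l * m + r + (k * m + s) < M * m \<longleftrightarrow> l + k < M"
    proof
      assume "l + k < M"
      hence "Suc (l + k) * m \<le> M * m" by (intro mult_le_mono1) simp
      thus "l * m + r + (k * m + s) < M * m" using rs by (simp add: algebra_simps)
    next
      assume "l * m + r + (k * m + s) < M * m"
      hence "(l + k) * m < M * m" by (simp add: algebra_simps)
      thus "l + k < M" by simp
    qed
    thus ?thesis using that by (simp add: block w_def mult_ac)
  qed
  have "(\<Sum>i<M * m. \<Sum>j<M * m. if i + j < M * m then f i * f j else 0)
      = (\<Sum>l<M. \<Sum>r<m. \<Sum>k<M. \<Sum>s<m. w l k * (f r * f s))"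
    unfolding sum_blocks by (intro sum.cong refl) (simp add: *)
  also have "\<dots> = (\<Sum>l<M. \<Sum>r<m. \<Sum>k<M. w l k * f r * (\<Sum>s<m. f s))"
    by (simp add: sum_distrib_left mult_ac)
  also have "\<dots> = 0" by (simp add: zero)
  finally show ?thesis .
qed

subsection \<open>The summands at roots of unity\<close>

lemma regular_at_qF [simp]: "regular_at \<zeta> qF"
  by (rule regular_at_to_fract)

lemma value_at_qF [simp]: "value_at \<zeta> qF = \<zeta>"
  by (simp only: value_at_to_fract poly_at_simps)

lemma regular_at_qF_power [simp]: "regular_at \<zeta> (qF ^ k)"
  by (rule regular_at_power) (rule regular_at_qF)

lemma value_at_qF_power [simp]: "value_at \<zeta> (qF ^ k) = \<zeta> ^ k"
  by (simp only: value_at_power regular_at_qF value_at_qF)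

lemma regular_at_qint: "regular_at \<zeta> f \<Longrightarrow> regular_at \<zeta> (qint f k)"
  and value_at_qint: "regular_at \<zeta> f \<Longrightarrow> value_at \<zeta> (qint f k) = qint (value_at \<zeta> f) k"
  unfolding qint_def by (simp_all add: vanishes_at_sum value_at_sum regular_at_power value_at_power)

lemma regular_at_qpoch: "regular_at \<zeta> x \<Longrightarrow> regular_at \<zeta> p \<Longrightarrow> regular_at \<zeta> (qpoch x p k)"
  and value_at_qpoch: "regular_at \<zeta> x \<Longrightarrow> regular_at \<zeta> p \<Longrightarrow>
        value_at \<zeta> (qpoch x p k) = qpoch (value_at \<zeta> x) (value_at \<zeta> p) k"
  unfolding qpoch_def
  by (simp_all add: regular_at_prod value_at_prod regular_at_power value_at_power value_at_diff
        vanishes_at_diff regular_at_mult value_at_mult[of _ 0 _ 0])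

lemma qint_mult: "(1 - x) * qint x k = 1 - x ^ k" for x :: "'a::comm_ring_1"
  by (simp add: qint_def one_diff_power_eq)

lemma qF_power_neq_1: "k > 0 \<Longrightarrow> qF ^ k \<noteq> 1"
proof
  assume "k > 0" and "qF ^ k = 1"
  hence "qX ^ k = 1" by (simp flip: to_fract_power to_fract_1)
  hence "degree (qX ^ k) = 0" by simp
  thus False using \<open>k > 0\<close> by (simp add: degree_power_eq)
qed

interpretation qF: generic_q qF
  by unfold_locales (simp_all add: qF_power_neq_1)

definition qratio :: "nat \<Rightarrow> rat poly fract" where
  "qratio k = qpoch qF (qF\<^sup>2) k / qpoch (qF\<^sup>2) (qF\<^sup>2) k"

lemma cq_eq: "cq k = qint qF (4 * k + 1) * qratio k ^ 6 * qF ^ k"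
  by (simp add: cq_def qratio_def power_divide)

section \<open>Watson's transformation at a primitive root of odd order\<close>

locale odd_primitive_root =
  fixes \<zeta> :: complex and m N :: nat
  assumes primitive: "\<zeta> \<in> primitive_roots_unity m"
    and m_eq: "m = 2 * N + 1"
    and m_gt_1: "m > 1"
begin

lemma power_m [simp]: "\<zeta> ^ m = 1"
  using primitive by (simp add: primitive_roots_unity_def)

lemma power_m_mult [simp]: "\<zeta> ^ (m * k) = 1" "\<zeta> ^ (k * m) = 1"
  by (simp_all only: mult.commute[of k] power_mult power_m power_one)

lemma power_eq_1_iff: "\<zeta> ^ k = 1 \<longleftrightarrow> m dvd k"
proof
  assume "\<zeta> ^ k = 1"
  have "\<zeta> ^ k = \<zeta> ^ (m * (k div m)) * \<zeta> ^ (k mod m)"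
    unfolding power_add[symmetric] by simp
  hence "\<zeta> ^ (k mod m) = 1" using \<open>\<zeta> ^ k = 1\<close> by simp
  moreover have "k mod m < m" using m_gt_1 by simp
  ultimately have "k mod m = 0"
    using primitive by (auto simp: primitive_roots_unity_def)
  thus "m dvd k" by auto
qed auto

lemma root_nonzero [simp]: "\<zeta> \<noteq> 0"
  using power_m m_gt_1 by (metis power_0_left zero_neq_one not_less_zero)

lemma root_neq_1: "\<zeta> \<noteq> 1"
  using power_eq_1_iff[of 1] m_gt_1 by auto

text \<open>2 is invertible modulo the odd order \<open>m\<close>. This keeps
  \<open>(q^2; q^2)_k\<close> with \<open>k < m\<close> from vanishing at \<zeta>.\<close>

lemma even_power_neq_1: "0 < k \<Longrightarrow> k < m \<Longrightarrow> \<zeta> ^ (2 * k) \<noteq> 1"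
proof
  assume k: "0 < k" "k < m" and "\<zeta> ^ (2 * k) = 1"
  hence "m dvd 2 * k" by (simp add: power_eq_1_iff)
  moreover have "coprime m 2" by (simp add: m_eq)
  ultimately have "m dvd k" using coprime_dvd_mult_right_iff by blast
  thus False using k by (auto dest: dvd_imp_le)
qed

lemma unit_at_qF_power: "unit_at \<zeta> (qF ^ k)"
  by (simp add: unit_at_def)

lemma unit_at_1_minus_qF: "unit_at \<zeta> (1 - qF)"
  using root_neq_1 by (simp add: unit_at_def value_at_diff vanishes_at_diff)

lemma vanishes_at_1_minus_qF_power: "m dvd k \<Longrightarrow> vanishes_at \<zeta> 1 (1 - qF ^ k)"
  unfolding vanishes_at_1_iff by (auto simp: value_at_diff vanishes_at_diff)

lemma vanishes_at_qint: "m dvd k \<Longrightarrow> vanishes_at \<zeta> 1 (qint qF k)"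
proof -
  assume "m dvd k"
  moreover have "qint qF k = (1 - qF ^ k) / (1 - qF)"
    using unit_at_nonzero[OF unit_at_1_minus_qF] by (simp flip: qint_mult)
  ultimately show ?thesis
    using vanishes_at_divide_unit[OF vanishes_at_1_minus_qF_power unit_at_1_minus_qF] by simp
qed

text \<open>Only the value of \<open>x\<close> at \<zeta> enters, so this covers
  \<open>(q^2; q^2)_k\<close>, its perturbations by \<open>q^m\<close> and \<open>q^(-m)\<close>,
  and products that start in a later block.\<close>

lemma unit_at_qpoch:
  assumes "regular_at \<zeta> x" "value_at \<zeta> x = \<zeta>\<^sup>2" "k < m"
  shows "unit_at \<zeta> (qpoch x (qF\<^sup>2) k)"
proof -
  have "\<zeta>\<^sup>2 * (\<zeta>\<^sup>2) ^ i \<noteq> 1" if "i < k" for i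
    using even_power_neq_1[of "Suc i"] that assms(3)
    by (simp flip: power_mult power_add)
  hence "qpoch (\<zeta>\<^sup>2) (\<zeta>\<^sup>2) k \<noteq> 0" by (rule qpoch_nonzero)
  thus ?thesis
    using assms by (simp add: unit_at_def regular_at_qpoch value_at_qpoch)
qed

text \<open>The perturbations by \<open>q^m\<close> and \<open>q^(-m)\<close> cancel to first order:
  each pair of factors changes by \<open>- x (1 - q^m)^2 / q^m\<close>, which has a double
  zero.\<close>

lemma qpoch_pair_cong:
  assumes "regular_at \<zeta> a"
  shows "vanishes_at \<zeta> 2 (qpoch (a * qF ^ m) (qF\<^sup>2) k * qpoch (a / qF ^ m) (qF\<^sup>2) k - qpoch a (qF\<^sup>2) k ^ 2)"
proof -
  define x where "x i = a * (qF\<^sup>2) ^ i" for i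
  have reg: "regular_at \<zeta> (x i)" for i
    unfolding x_def using assms by (intro regular_at_mult) (auto simp: regular_at_power)
  have "(1 - x i * qF ^ m) * (1 - x i / qF ^ m) - (1 - x i) ^ 2 = - (x i * (1 - qF ^ m) ^ 2 / qF ^ m)" for i
    using qF.q_nonzero by (simp add: field_simps power2_eq_square)
  moreover have "vanishes_at \<zeta> 2 (- (x i * (1 - qF ^ m) ^ 2 / qF ^ m))" for i
    using vanishes_at_power[OF vanishes_at_1_minus_qF_power[OF dvd_refl], of 2]
    by (intro vanishes_at_uminus vanishes_at_divide_unit vanishes_at_mult_left reg unit_at_qF_power) simp
  ultimately have "vanishes_at \<zeta> 2 ((1 - x i * qF ^ m) * (1 - x i / qF ^ m) - (1 - x i) ^ 2)" for i
    by simp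
  moreover have "regular_at \<zeta> ((1 - x i * qF ^ m) * (1 - x i / qF ^ m))" "regular_at \<zeta> ((1 - x i) ^ 2)" for i
    by (intro regular_at_mult regular_at_power vanishes_at_diff vanishes_at_divide_unit reg unit_at_qF_power
          regular_at_1 regular_at_qF_power)+
  ultimately have "vanishes_at \<zeta> 2 ((\<Prod>i<k. (1 - x i * qF ^ m) * (1 - x i / qF ^ m)) - (\<Prod>i<k. (1 - x i) ^ 2))"
    by (intro vanishes_at_prod_diff)
  thus ?thesis
    by (simp add: qpoch_def x_def prod.distrib prod_power_distrib mult_ac)
qed

text \<open>Watson's identity holds exactly for perturbed summands. By
  \<open>qpoch_pair_cong\<close>, removing the perturbation changes either side only to order
  2.\<close>

lemma sum_cq_cong:
  "vanishes_at \<zeta> 2 ((\<Sum>k\<le>N. cq k) - qint qF m / qF ^ N * (\<Sum>k\<le>N. qratio k ^ 4 * qF ^ (2 * k)))"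
proof -
  define Q where "Q = qF ^ m"
  \<comment> \<open>\<open>A\<close> and \<open>B\<close> perturb \<open>(q; q^2)_k^2\<close> and
    \<open>(q^2; q^2)_k^2\<close>. With them \<open>w\<close> and \<open>x\<close> are the two
    Watson summands; \<open>w\<close> approximates \<open>(1 - q) cq k\<close> because it carries
    \<open>1 - q^(4k+1)\<close> instead of \<open>[4k+1]\<close>.\<close>
  define A B where "A k = qpoch (qF * Q) (qF\<^sup>2) k * qpoch (qF / Q) (qF\<^sup>2) k"
    and "B k = qpoch (qF\<^sup>2 * Q) (qF\<^sup>2) k * qpoch (qF\<^sup>2 / Q) (qF\<^sup>2) k" for k
  define w where "w k = (1 - qF ^ (4 * k + 1)) * qratio k ^ 4 * qF ^ k * (A k / B k)" for k
  define x where "x k = qratio k ^ 2 * qF ^ (2 * k) * (A k / qpoch (qF\<^sup>2) (qF\<^sup>2) k ^ 2)" for k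
  have Q: "Q = qF * (qF\<^sup>2) ^ N"
    by (simp add: Q_def m_eq power_mult)
  have Q_pow: "(qF\<^sup>2) ^ Suc N = qF * Q" "qF * (qF * Q) = qF\<^sup>2 * Q"
    unfolding Q by (simp_all add: power2_eq_square)
  have Q_div: "1 / (qF\<^sup>2) ^ N = qF / Q" "qF / (qF\<^sup>2) ^ N = qF\<^sup>2 / Q"
    unfolding Q using qF.q_nonzero by (simp_all add: power2_eq_square)
  have watson: "(\<Sum>k\<le>N. w k) = (1 - Q) / qF ^ N * (\<Sum>k\<le>N. x k)"
  proof -
    have "(\<Sum>k\<le>N. w k) = (\<Sum>r\<le>N. (1 - qF ^ (4 * r + 1)) * qpoch qF (qF\<^sup>2) r ^ 4 * qpoch ((qF\<^sup>2) ^ Suc N) (qF\<^sup>2) r *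
        qpoch (1 / (qF\<^sup>2) ^ N) (qF\<^sup>2) r / (qpoch (qF\<^sup>2) (qF\<^sup>2) r ^ 4 * qpoch (qF / (qF\<^sup>2) ^ N) (qF\<^sup>2) r *
        qpoch (qF * (qF\<^sup>2) ^ Suc N) (qF\<^sup>2) r) * qF ^ r)"
      unfolding Q_div Q_pow w_def A_def B_def qratio_def
      by (intro sum.cong refl) (simp add: power_divide mult_ac)
    also note qF.watson_special
    also have "(1 - qF ^ (2 * N + 1)) / qF ^ N *
     (\<Sum>j\<le>N. qpoch qF (qF\<^sup>2) j ^ 2 * qpoch ((qF\<^sup>2) ^ Suc N) (qF\<^sup>2) j * qpoch (1 / (qF\<^sup>2) ^ N) (qF\<^sup>2) j /
        qpoch (qF\<^sup>2) (qF\<^sup>2) j ^ 4 * (qF\<^sup>2) ^ j) = (1 - Q) / qF ^ N * (\<Sum>k\<le>N. x k)"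
      unfolding Q_div Q_pow x_def A_def qratio_def Q_def[symmetric] m_eq[symmetric] power_mult[of qF 2]
      by (rule arg_cong[where f = "\<lambda>s. _ * s"], rule sum.cong)
         (simp_all add: power_divide power4_eq_xxxx power2_eq_square mult_ac flip: power_mult_distrib)
    finally show ?thesis .
  qed
  have reg_Q: "regular_at \<zeta> Q" "unit_at \<zeta> Q" "value_at \<zeta> Q = 1"
    using unit_at_qF_power[of m] by (simp_all add: Q_def)
  have reg_A: "regular_at \<zeta> (A k)" for k
    unfolding A_def using reg_Q
    by (intro regular_at_mult regular_at_qpoch vanishes_at_divide_unit) auto
  have congA: "vanishes_at \<zeta> 2 (A k - qpoch qF (qF\<^sup>2) k ^ 2)" for k
    unfolding A_def Q_def by (rule qpoch_pair_cong) simp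
  have congB: "vanishes_at \<zeta> 2 (B k - qpoch (qF\<^sup>2) (qF\<^sup>2) k ^ 2)" for k
    unfolding B_def Q_def by (rule qpoch_pair_cong) simp
  have unit_p: "unit_at \<zeta> (qpoch (qF\<^sup>2) (qF\<^sup>2) k)" if "k \<le> N" for k
    using that by (intro unit_at_qpoch) (simp_all add: m_eq)
  have unit_B: "unit_at \<zeta> (B k)" if "k \<le> N" for k
    unfolding B_def using that reg_Q
    by (intro unit_at_mult unit_at_qpoch regular_at_mult vanishes_at_divide_unit)
       (simp_all add: m_eq value_at_mult[of _ 0 _ 0] value_at_divide)
  have reg_t: "regular_at \<zeta> (qratio k)" if "k \<le> N" for k
    unfolding qratio_def using unit_p[OF that] by (intro vanishes_at_divide_unit regular_at_qpoch) auto
  have "vanishes_at \<zeta> 2 (w k - (1 - qF) * cq k)" if "k \<le> N" for k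
  proof -
    have "(1 - qF) * cq k = (1 - qF ^ (4 * k + 1)) * qratio k ^ 6 * qF ^ k"
      by (simp only: cq_eq mult.assoc flip: qint_mult)
    also have "qratio k ^ 6 = qratio k ^ 4 * (qpoch qF (qF\<^sup>2) k ^ 2 / qpoch (qF\<^sup>2) (qF\<^sup>2) k ^ 2)"
      unfolding qratio_def power_divide[symmetric] power_add[symmetric] by simp
    finally have "w k - (1 - qF) * cq k = (1 - qF ^ (4 * k + 1)) * qratio k ^ 4 * qF ^ k *
        (A k / B k - qpoch qF (qF\<^sup>2) k ^ 2 / qpoch (qF\<^sup>2) (qF\<^sup>2) k ^ 2)"
      unfolding w_def right_diff_distrib by (simp only: mult_ac)
    moreover have "vanishes_at \<zeta> 2 \<dots>"
      using that by (intro vanishes_at_mult_left regular_at_mult vanishes_at_divide_diff congA congB reg_A unit_B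
          unit_at_power unit_p regular_at_power reg_t vanishes_at_diff) simp_all
    ultimately show ?thesis by simp
  qed
  hence "vanishes_at \<zeta> 2 (\<Sum>k\<le>N. w k - (1 - qF) * cq k)"
    by (intro vanishes_at_sum) simp
  hence 1: "vanishes_at \<zeta> 2 ((\<Sum>k\<le>N. w k) - (1 - qF) * (\<Sum>k\<le>N. cq k))"
    by (simp add: sum_subtractf sum_distrib_left)
  have "vanishes_at \<zeta> 2 (x k - qratio k ^ 4 * qF ^ (2 * k))" if "k \<le> N" for k
  proof -
    have "qratio k ^ 4 = qratio k ^ 2 * (qpoch qF (qF\<^sup>2) k ^ 2 / qpoch (qF\<^sup>2) (qF\<^sup>2) k ^ 2)"
      unfolding qratio_def power_divide[symmetric] power_add[symmetric] by simp
    hence "x k - qratio k ^ 4 * qF ^ (2 * k) = qratio k ^ 2 * qF ^ (2 * k) *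
        (A k / qpoch (qF\<^sup>2) (qF\<^sup>2) k ^ 2 - qpoch qF (qF\<^sup>2) k ^ 2 / qpoch (qF\<^sup>2) (qF\<^sup>2) k ^ 2)"
      by (simp add: x_def algebra_simps)
    moreover have "vanishes_at \<zeta> 2 (A k / qpoch (qF\<^sup>2) (qF\<^sup>2) k ^ 2 - qpoch qF (qF\<^sup>2) k ^ 2 / qpoch (qF\<^sup>2) (qF\<^sup>2) k ^ 2)"
      unfolding diff_divide_distrib[symmetric]
      using that by (intro vanishes_at_divide_unit congA unit_at_power unit_p)
    hence "vanishes_at \<zeta> 2 (qratio k ^ 2 * qF ^ (2 * k) *
        (A k / qpoch (qF\<^sup>2) (qF\<^sup>2) k ^ 2 - qpoch qF (qF\<^sup>2) k ^ 2 / qpoch (qF\<^sup>2) (qF\<^sup>2) k ^ 2))"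
      using that by (intro vanishes_at_mult_left regular_at_mult regular_at_power reg_t regular_at_qF)
    ultimately show ?thesis by simp
  qed
  hence "vanishes_at \<zeta> 2 (\<Sum>k\<le>N. x k - qratio k ^ 4 * qF ^ (2 * k))"
    by (intro vanishes_at_sum) simp
  hence "vanishes_at \<zeta> 2 ((\<Sum>k\<le>N. x k) - (\<Sum>k\<le>N. qratio k ^ 4 * qF ^ (2 * k)))"
    unfolding sum_subtractf .
  moreover have "regular_at \<zeta> ((1 - Q) / qF ^ N)"
    using reg_Q by (intro vanishes_at_divide_unit unit_at_qF_power vanishes_at_diff) simp_all
  ultimately have 2: "vanishes_at \<zeta> 2 ((1 - Q) / qF ^ N * ((\<Sum>k\<le>N. x k) - (\<Sum>k\<le>N. qratio k ^ 4 * qF ^ (2 * k))))"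
    by (intro vanishes_at_mult_left)
  have "1 - qF \<noteq> 0" using unit_at_1_minus_qF by (rule unit_at_nonzero)
  hence qint: "qint qF m = (1 - Q) / (1 - qF)"
    by (simp add: Q_def flip: qint_mult)
  have "(\<Sum>k\<le>N. cq k) - qint qF m / qF ^ N * (\<Sum>k\<le>N. qratio k ^ 4 * qF ^ (2 * k)) =
      ((1 - Q) / qF ^ N * ((\<Sum>k\<le>N. x k) - (\<Sum>k\<le>N. qratio k ^ 4 * qF ^ (2 * k)))
        - ((\<Sum>k\<le>N. w k) - (1 - qF) * (\<Sum>k\<le>N. cq k))) / (1 - qF)"
    unfolding watson qint using \<open>1 - qF \<noteq> 0\<close> qF.q_nonzero by (simp add: divide_simps) (simp add: algebra_simps)
  thus ?thesis
    using vanishes_at_divide_unit[OF vanishes_at_diff[OF 2 1] unit_at_1_minus_qF] by simp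
qed

section \<open>Periodicity in blocks of length m\<close>

lemma qratio_add:
  "qratio (k + r) = qratio k * (qpoch (qF * (qF\<^sup>2) ^ k) (qF\<^sup>2) r / qpoch (qF\<^sup>2 * (qF\<^sup>2) ^ k) (qF\<^sup>2) r)"
  by (simp add: qratio_def qpoch_add)

lemma block_start:
  "regular_at \<zeta> (qF * (qF\<^sup>2) ^ (l * m))" "value_at \<zeta> (qF * (qF\<^sup>2) ^ (l * m)) = \<zeta>"
  "regular_at \<zeta> (qF\<^sup>2 * (qF\<^sup>2) ^ (l * m))" "value_at \<zeta> (qF\<^sup>2 * (qF\<^sup>2) ^ (l * m)) = \<zeta>\<^sup>2"
proof -
  have "(qF\<^sup>2) ^ (l * m) = qF ^ (m * (2 * l))" by (simp flip: power_mult add: mult_ac)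
  thus "regular_at \<zeta> (qF * (qF\<^sup>2) ^ (l * m))" "value_at \<zeta> (qF * (qF\<^sup>2) ^ (l * m)) = \<zeta>"
    "regular_at \<zeta> (qF\<^sup>2 * (qF\<^sup>2) ^ (l * m))" "value_at \<zeta> (qF\<^sup>2 * (qF\<^sup>2) ^ (l * m)) = \<zeta>\<^sup>2"
    by (simp_all add: regular_at_mult value_at_mult[of _ 0 _ 0])
qed

text \<open>In a full block the numerator contains \<open>1 - Q^(2l+1)\<close> at index
  \<open>N\<close>, and the denominator \<open>1 - Q^(2l+2)\<close> at its last index, with
  \<open>Q = q^m\<close>. The common factor \<open>1 - Q\<close> cancels; what is left of the
  denominator is a unit, since \<open>qint Q (2 * l + 2)\<close> has value \<open>2l+2\<close> at
  \<zeta>.\<close>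

lemma regular_at_qratio_multiple: "regular_at \<zeta> (qratio (l * m))"
proof (induction l)
  case (Suc l)
  define x where "x = (qF\<^sup>2) ^ (l * m)"
  define Q where "Q = qF ^ m"
  have x: "x = Q ^ (2 * l)" by (simp add: x_def Q_def mult_ac flip: power_mult)
  have Q: "regular_at \<zeta> Q" "value_at \<zeta> Q = 1" by (simp_all add: Q_def)
  have Q_neq_1: "1 - Q \<noteq> 0"
    using qF_power_neq_1[of m] m_gt_1 by (simp add: Q_def)
  define R where "R = (\<Prod>i\<in>{..<m} - {N}. 1 - qF * x * (qF\<^sup>2) ^ i)"
  have "qpoch (qF * x) (qF\<^sup>2) m = (1 - qF * x * (qF\<^sup>2) ^ N) * R"
    unfolding qpoch_def R_def by (rule prod.remove) (simp_all add: m_eq)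
  also have "qF * x * (qF\<^sup>2) ^ N = Q ^ (2 * l + 1)"
    by (simp add: x Q_def m_eq power_mult)
  finally have num: "qpoch (qF * x) (qF\<^sup>2) m = (1 - Q) * qint Q (2 * l + 1) * R"
    by (simp only: qint_mult)
  define S where "S = qpoch (qF\<^sup>2 * x) (qF\<^sup>2) (2 * N)"
  have "qpoch (qF\<^sup>2 * x) (qF\<^sup>2) m = S * (1 - qF\<^sup>2 * x * (qF\<^sup>2) ^ (2 * N))"
    by (simp add: m_eq S_def qpoch_Suc)
  also have "qF\<^sup>2 * (qF\<^sup>2) ^ (2 * N) = Q\<^sup>2"
    unfolding Q_def power_mult[symmetric] power_add[symmetric]
    by (rule arg_cong[where f = "power qF"]) (simp add: m_eq)
  hence "qF\<^sup>2 * x * (qF\<^sup>2) ^ (2 * N) = Q ^ (2 * l + 2)"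
    by (simp add: x power2_eq_square mult_ac)
  finally have den: "qpoch (qF\<^sup>2 * x) (qF\<^sup>2) m = (1 - Q) * (S * qint Q (2 * l + 2))"
    by (simp only: qint_mult[symmetric] mult_ac)
  have "unit_at \<zeta> S"
    unfolding S_def x_def by (intro unit_at_qpoch block_start) (simp add: m_eq)
  moreover have "unit_at \<zeta> (qint Q (2 * l + 2))"
    unfolding unit_at_def value_at_qint[OF Q(1)] Q(2)
  proof
    show "qint 1 (2 * l + 2) \<noteq> (0 :: complex)"
      unfolding qint_def power_one sum_constant by (simp flip: of_nat_Suc del: of_nat_Suc)
  qed (rule regular_at_qint[OF Q(1)])
  moreover have "regular_at \<zeta> (qint Q (2 * l + 1) * R)"
    unfolding R_def x_def using Q
    by (intro regular_at_mult regular_at_qint regular_at_prod vanishes_at_diff regular_at_power block_start) simp_all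
  ultimately have "regular_at \<zeta> (qint Q (2 * l + 1) * R / (S * qint Q (2 * l + 2)))"
    by (intro vanishes_at_divide_unit unit_at_mult)
  moreover have "qpoch (qF * x) (qF\<^sup>2) m / qpoch (qF\<^sup>2 * x) (qF\<^sup>2) m =
      qint Q (2 * l + 1) * R / (S * qint Q (2 * l + 2))"
    unfolding num den mult.assoc using Q_neq_1 by (rule mult_divide_mult_cancel_left)
  ultimately have "regular_at \<zeta> (qratio (l * m) * (qpoch (qF * x) (qF\<^sup>2) m / qpoch (qF\<^sup>2 * x) (qF\<^sup>2) m))"
    using Suc by (simp only: regular_at_mult)
  thus ?case
    using qratio_add[of "l * m" m] by (simp only: mult_Suc add.commute[of m] x_def)
qed (simp add: qratio_def)

text \<open>The partial block \<open>s l\<close> has a value independent of \<open>l\<close>,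
  because \<open>q^(2lm)\<close> is 1 at \<zeta>; and \<open>s 0\<close> is
  \<open>qratio r\<close>.\<close>

lemma qratio_block:
  assumes "r < m"
  shows "regular_at \<zeta> (qratio (l * m + r))"
    and "value_at \<zeta> (qratio (l * m + r)) = value_at \<zeta> (qratio (l * m)) * value_at \<zeta> (qratio r)"
proof -
  define s where "s l = qpoch (qF * (qF\<^sup>2) ^ (l * m)) (qF\<^sup>2) r / qpoch (qF\<^sup>2 * (qF\<^sup>2) ^ (l * m)) (qF\<^sup>2) r" for l
  have unit: "unit_at \<zeta> (qpoch (qF\<^sup>2 * (qF\<^sup>2) ^ (l * m)) (qF\<^sup>2) r)" for l
    using assms by (intro unit_at_qpoch block_start)
  have s: "regular_at \<zeta> (s l)" "value_at \<zeta> (s l) = qpoch \<zeta> (\<zeta>\<^sup>2) r / qpoch (\<zeta>\<^sup>2) (\<zeta>\<^sup>2) r" for l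
    using unit[of l] block_start[of l]
    by (simp_all add: s_def vanishes_at_divide_unit value_at_divide unit_at_def regular_at_qpoch value_at_qpoch)
  have "qratio (l * m + r) = qratio (l * m) * s l" for l
    by (simp add: qratio_add s_def)
  moreover from this[of 0] have "qratio r = s 0" by (simp add: qratio_def)
  ultimately show "regular_at \<zeta> (qratio (l * m + r))"
    "value_at \<zeta> (qratio (l * m + r)) = value_at \<zeta> (qratio (l * m)) * value_at \<zeta> (qratio r)"
    using s regular_at_qratio_multiple[of l] by (simp_all add: regular_at_mult value_at_mult[of _ 0 _ 0])
qed

lemma regular_at_qratio: "regular_at \<zeta> (qratio k)"
  using qratio_block(1)[of "k mod m" "k div m"] m_gt_1 by simp

lemma regular_at_cq: "regular_at \<zeta> (cq k)"
  unfolding cq_eq by (intro regular_at_mult regular_at_power regular_at_qint regular_at_qratio) simp_all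

lemma qint_root_cong:
  assumes "\<zeta> ^ a = \<zeta> ^ b"
  shows "qint \<zeta> a = qint \<zeta> b"
proof -
  have "(1 - \<zeta>) * qint \<zeta> a = (1 - \<zeta>) * qint \<zeta> b"
    using assms by (simp add: qint_mult)
  thus ?thesis using root_neq_1 by simp
qed

text \<open>At \<zeta> the factors \<open>[4k+1]\<close> and \<open>q^k\<close> depend only on
  \<open>k\<close> modulo \<open>m\<close>, so the sixth power of \<open>qratio\<close> alone
  contributes the block factor.\<close>

lemma value_at_cq_block:
  assumes "r < m"
  shows "value_at \<zeta> (cq (l * m + r)) = value_at \<zeta> (qratio (l * m)) ^ 6 * value_at \<zeta> (cq r)"
proof -
  have "4 * (l * m + r) + 1 = m * (4 * l) + (4 * r + 1)" by (simp add: algebra_simps)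
  hence "\<zeta> ^ (4 * (l * m + r) + 1) = \<zeta> ^ (4 * r + 1)"
    by (simp only: power_add[of _ "m * _"] power_m_mult mult_1)
  hence "qint \<zeta> (4 * (l * m + r) + 1) = qint \<zeta> (4 * r + 1)" by (rule qint_root_cong)
  moreover have "\<zeta> ^ (l * m + r) = \<zeta> ^ r" by (simp add: power_add)
  ultimately show ?thesis
    unfolding cq_eq using qratio_block(2)[OF assms]
    by (simp add: value_at_mult[of _ 0 _ 0] value_at_power regular_at_mult regular_at_power regular_at_qint
          value_at_qint regular_at_qratio power_mult_distrib mult_ac)
qed

text \<open>For \<open>k > N\<close> the product \<open>(q; q^2)_k\<close> contains
  \<open>1 - q^m\<close>, while \<open>(q^2; q^2)_k\<close> is still a unit for
  \<open>k < m\<close>; the quotient enters \<open>cq\<close> to the sixth power.\<close>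

lemma vanishes_at_cq:
  assumes "N < k" "k < m"
  shows "vanishes_at \<zeta> 6 (cq k)"
proof -
  have "qpoch qF (qF\<^sup>2) k = (1 - qF * (qF\<^sup>2) ^ N) * (\<Prod>i\<in>{..<k} - {N}. 1 - qF * (qF\<^sup>2) ^ i)"
    unfolding qpoch_def using assms by (intro prod.remove) simp_all
  also have "qF * (qF\<^sup>2) ^ N = qF ^ m" by (simp add: m_eq power_mult)
  finally have "vanishes_at \<zeta> 1 (qpoch qF (qF\<^sup>2) k)"
    by (simp only:) (intro vanishes_at_mult_right vanishes_at_1_minus_qF_power regular_at_prod
        vanishes_at_diff regular_at_mult regular_at_power regular_at_1 regular_at_qF dvd_refl)
  hence "vanishes_at \<zeta> 1 (qratio k)"
    unfolding qratio_def using assms by (intro vanishes_at_divide_unit unit_at_qpoch) simp_all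
  from vanishes_at_power[OF this, of 6] show ?thesis
    unfolding cq_eq by (intro vanishes_at_mult_left vanishes_at_mult_right regular_at_qint) simp_all
qed

text \<open>By \<open>sum_cq_cong\<close> the sum up to \<open>N\<close> agrees at \<zeta> with a
  multiple of \<open>[m]\<close>, and the remaining summands vanish there.\<close>

lemma sum_cq_value: "(\<Sum>r<m. value_at \<zeta> (cq r)) = 0"
proof -
  define X where "X = qint qF m / qF ^ N * (\<Sum>k\<le>N. qratio k ^ 4 * qF ^ (2 * k))"
  have "vanishes_at \<zeta> 1 X"
    unfolding X_def by (intro vanishes_at_mult_right vanishes_at_divide_unit vanishes_at_qint dvd_refl
        unit_at_qF_power vanishes_at_sum regular_at_mult regular_at_power regular_at_qratio regular_at_qF)
  moreover have "vanishes_at \<zeta> 1 ((\<Sum>k\<le>N. cq k) - X)"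
    using sum_cq_cong unfolding X_def by (rule vanishes_at_mono) simp
  ultimately have "vanishes_at \<zeta> 1 (\<Sum>k\<le>N. cq k)"
    using vanishes_at_add by fastforce
  hence "(\<Sum>k\<le>N. value_at \<zeta> (cq k)) = 0"
    unfolding vanishes_at_1_iff by (simp add: value_at_sum regular_at_cq)
  moreover have "(\<Sum>r<m. value_at \<zeta> (cq r)) = (\<Sum>k\<le>N. value_at \<zeta> (cq k))"
    using vanishes_at_mono[OF vanishes_at_cq, of _ 1] unfolding vanishes_at_1_iff
    by (intro sum.mono_neutral_right) (auto simp: m_eq)
  ultimately show ?thesis by simp
qed

section \<open>The double sum at a root of unity\<close>

lemma vanishes_at_double_sum:
  assumes "n > 0" "m dvd n"
  shows "vanishes_at \<zeta> 1 (\<Sum>k=0..n - 1. \<Sum>j=0..k. cq j * cq (k - j))"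
proof -
  obtain M where n: "n = M * m" using assms(2) by (metis dvd_def mult.commute)
  define f where "f k = value_at \<zeta> (cq k)" for k
  have "value_at \<zeta> (\<Sum>k=0..n - 1. \<Sum>j=0..k. cq j * cq (k - j)) = (\<Sum>k=0..n - 1. \<Sum>j=0..k. f j * f (k - j))"
    by (simp add: f_def value_at_sum value_at_mult[of _ 0 _ 0] vanishes_at_sum regular_at_mult regular_at_cq)
  also have "\<dots> = (\<Sum>i<n. \<Sum>j<n. if i + j < n then f i * f j else 0)"
    using assms(1) by (rule sum_convolution_square)
  also have "\<dots> = 0"
    unfolding n
  proof (rule truncated_convolution_square_zero)
    show "f (l * m + r) = value_at \<zeta> (qratio (l * m)) ^ 6 * f r" if "r < m" for l r
      unfolding f_def using that by (rule value_at_cq_block)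
    \<comment> \<open>Since \<open>m = 2N+1\<close>, the condition \<open>m \<le> 2 * r\<close> says
      \<open>r > N\<close>.\<close>
    show "f r = 0" if "r < m" "m \<le> 2 * r" for r
      using vanishes_at_mono[OF vanishes_at_cq, of r 1] that unfolding vanishes_at_1_iff f_def m_eq by simp
    show "(\<Sum>r<m. f r) = 0" unfolding f_def by (rule sum_cq_value)
  qed
  finally show ?thesis
    unfolding vanishes_at_1_iff by (simp add: vanishes_at_sum regular_at_mult regular_at_cq)
qed

text \<open>\<open>S^2 - X^2\<close> splits into \<open>S - X\<close>, of order 2, and
  \<open>S + X\<close>, of order 1. Replacing the truncated square by \<open>S^2\<close> costs only
  terms of order 6.\<close>

lemma double_sum_cong:
  "vanishes_at \<zeta> 3 ((\<Sum>k=0..m - 1. \<Sum>j=0..k. cq j * cq (k - j)) -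
     (qint qF m / qF ^ N * (\<Sum>k\<le>N. qratio k ^ 4 * qF ^ (2 * k))) ^ 2)"
proof -
  define S X where "S = (\<Sum>k\<le>N. cq k)"
    and "X = qint qF m / qF ^ N * (\<Sum>k\<le>N. qratio k ^ 4 * qF ^ (2 * k))"
  have X: "vanishes_at \<zeta> 1 X"
    unfolding X_def by (intro vanishes_at_mult_right vanishes_at_divide_unit vanishes_at_qint dvd_refl
        unit_at_qF_power vanishes_at_sum regular_at_mult regular_at_power regular_at_qratio regular_at_qF)
  have SX: "vanishes_at \<zeta> 2 (S - X)"
    using sum_cq_cong unfolding S_def X_def .
  have "vanishes_at \<zeta> 1 (S - X)" using SX by (rule vanishes_at_mono) simp
  \<comment> \<open>\<open>S + X\<close> is written through \<open>S - X\<close> and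
    \<open>X\<close>, whose orders are known.\<close>
  hence "vanishes_at \<zeta> 1 ((S - X) + X + X)" using X by (intro vanishes_at_add)
  from vanishes_at_mult[OF SX this] have "vanishes_at \<zeta> 3 ((S - X) * ((S - X) + X + X))" by simp
  also have "(S - X) * ((S - X) + X + X) = S ^ 2 - X ^ 2"
    by (simp add: algebra_simps power2_eq_square)
  finally have 1: "vanishes_at \<zeta> 3 (S ^ 2 - X ^ 2)" .
  \<comment> \<open>\<open>g\<close> sums to the truncated square and \<open>h\<close> to
    \<open>S^2\<close>. They agree for \<open>i, j \<le> N\<close>, where
    \<open>i + j \<le> 2N < m\<close>; otherwise one of the two factors has order 6.\<close>
  define g h where "g i j = (if i + j < m then cq i * cq j else 0)"
    and "h i j = (if i \<le> N \<and> j \<le> N then cq i * cq j else 0)" for i j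
  have "S = (\<Sum>i<m. if i \<le> N then cq i else 0)"
    unfolding S_def by (rule sum.mono_neutral_cong_left) (auto simp: m_eq)
  hence "S ^ 2 = (\<Sum>i<m. \<Sum>j<m. h i j)"
    by (simp add: power2_eq_square sum_product h_def if_distrib cong: if_cong) (intro sum.cong, auto)
  moreover have "(\<Sum>k=0..m - 1. \<Sum>j=0..k. cq j * cq (k - j)) = (\<Sum>i<m. \<Sum>j<m. g i j)"
    unfolding g_def using m_gt_1 by (intro sum_convolution_square) simp
  moreover have "vanishes_at \<zeta> 3 (\<Sum>i<m. \<Sum>j<m. g i j - h i j)"
  proof (intro vanishes_at_sum)
    fix i j assume "i \<in> {..<m}" "j \<in> {..<m}"
    hence ij: "i < m" "j < m" by auto
    show "vanishes_at \<zeta> 3 (g i j - h i j)"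
    proof (cases "i \<le> N \<and> j \<le> N")
      case True
      thus ?thesis by (simp add: g_def h_def m_eq)
    next
      case False
      hence "vanishes_at \<zeta> 6 (cq i) \<or> vanishes_at \<zeta> 6 (cq j)"
        using ij vanishes_at_cq by (meson not_le)
      hence "vanishes_at \<zeta> 6 (cq i * cq j)"
        using regular_at_cq vanishes_at_mult_left vanishes_at_mult_right by blast
      hence "vanishes_at \<zeta> 3 (cq i * cq j)" by (rule vanishes_at_mono) simp
      thus ?thesis using False by (auto simp: g_def h_def)
    qed
  qed
  ultimately have "vanishes_at \<zeta> 3 ((\<Sum>k=0..m - 1. \<Sum>j=0..k. cq j * cq (k - j)) - S ^ 2)"
    by (simp add: sum_subtractf)
  from vanishes_at_add[OF this 1] show ?thesis by (simp add: X_def)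
qed

end

section \<open>Assembly of the local results\<close>

theorem theorem5p4:
  fixes n :: nat
  assumes "n > 0" and "odd n"
  shows "ratfun_cong
           (\<Sum>k = 0..n - 1. \<Sum>j = 0..k. cq j * cq (k - j))
           (qF powi (1 - int n) * qint qF n ^ 2 *
             (\<Sum>k = 0..(n - 1) div 2.
                qpoch qF (qF ^ 2) k ^ 4 / qpoch (qF ^ 2) (qF ^ 2) k ^ 4 * qF ^ (2 * k)) ^ 2)
           (qint qX n * cyclotomic n ^ 2)"
proof (cases "n = 1")
  case True
  have "ratfun_cong 1 1 P" for P
    unfolding ratfun_cong_def by (intro exI[of _ 0] exI[of _ 1]) simp
  thus ?thesis using True by (simp add: cq_def qint_def)
next
  case False
  with assms have n: "n > 1" by simp
  define L where "L = (\<Sum>k = 0..n - 1. \<Sum>j = 0..k. cq j * cq (k - j))"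
  define h where "h = (n - 1) div 2"
  define R where "R = qint qF n / qF ^ h * (\<Sum>k\<le>h. qratio k ^ 4 * qF ^ (2 * k))"
  have n_h: "n = 2 * h + 1" using assms by (simp add: h_def)
  \<comment> \<open>\<open>q^(1-n)\<close> is the square of \<open>q^(-h)\<close>, so the whole
    right-hand side is the square of \<open>R\<close>.\<close>
  have "1 - int n = - int (2 * h)" by (simp add: n_h)
  hence "qF powi (1 - int n) = 1 / (qF ^ h) ^ 2"
    by (simp only: power_int_minus power_int_of_nat) (simp add: divide_inverse mult.commute flip: power_mult)
  hence R: "qF powi (1 - int n) * qint qF n ^ 2 * (\<Sum>k = 0..(n - 1) div 2.
      qpoch qF (qF ^ 2) k ^ 4 / qpoch (qF ^ 2) (qF ^ 2) k ^ 4 * qF ^ (2 * k)) ^ 2 = R ^ 2"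
    by (simp add: R_def qratio_def power_divide power_mult_distrib h_def atLeast0AtMost)
  have "ratfun_cong L (R ^ 2) (qint qX n * cyclotomic n ^ 2)"
    using n
  proof (rule ratfun_cong_if_vanishes_at)
    fix z :: complex assume z: "z ^ n = 1" "z \<noteq> 1"
    show "vanishes_at z (if z \<in> primitive_roots_unity n then 3 else 1) (L - R ^ 2)"
    proof (cases "z \<in> primitive_roots_unity n")
      case True
      then interpret odd_primitive_root z n h
        by unfold_locales (use n n_h in auto)
      show ?thesis using double_sum_cong True by (simp add: L_def R_def)
    next
      case False
      \<comment> \<open>\<open>m\<close> is the exact order of \<open>z\<close>: odd as a divisor of
        \<open>n\<close>, and greater than 1 because \<open>z\<close> is not 1.\<close>
      obtain m where m: "m dvd n" "z \<in> primitive_roots_unity m"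
        using roots_unity_decompose[OF assms(1)] z(1) by blast
      have "odd m" using m(1) assms(2) dvd_trans by blast
      moreover have "m \<noteq> 1" using m(2) z(2) by (auto simp: primitive_roots_unity_def)
      ultimately interpret odd_primitive_root z m "(m - 1) div 2"
        by unfold_locales (use m in \<open>auto elim!: oddE\<close>)
      \<comment> \<open>\<open>[n]\<close> vanishes at \<open>z\<close> because \<open>m\<close>
        divides \<open>n\<close>. The sum in \<open>R\<close> reaches indices where denominators
        vanish at \<open>z\<close>; \<open>regular_at_qratio\<close> shows that its terms are
        regular all the same.\<close>
      have "vanishes_at z 1 R"
        unfolding R_def by (intro vanishes_at_mult_right vanishes_at_divide_unit vanishes_at_qint m(1)
            unit_at_qF_power vanishes_at_sum regular_at_mult regular_at_power regular_at_qratio regular_at_qF)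
      from vanishes_at_power[OF this, of 2] have "vanishes_at z 1 (R ^ 2)"
        by (rule vanishes_at_mono) simp
      thus ?thesis
        using False vanishes_at_diff[OF vanishes_at_double_sum[OF assms(1) m(1)]] by (simp add: L_def)
    qed
  qed
  thus ?thesis unfolding R L_def .
qed

end
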